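(* Let $p\in(0,1]$ and suppose that $\mathbb{E}[v^2]<\infty$. Then there exists a constant $C\in(0,\infty)$ such that $$\frac{w_{0,n}}{n}\xrightarrow[n\to\infty]{} C\quad\text{almost surely}$$ and $$\frac{w_{0,n}^+}{n}\xrightarrow[n\to\infty]{} C\quad\text{in }\mathcal{L}^1 .$$
   Context: Model. Fix $p\in(0,1]$. For integers $i<j$ let $v_{i,j}>0$ be i.i.d. random variables with the law of a random variable $v$, assumed not almost surely constant. Independently of the weights, each directed edge $(i,j)$, $i<j\in\mathbb{Z}$, is present with probability $p$, independently of the others. A path from $i$ to $j$ is a sequence of present edges $(i_0,i_1),(i_1,i_2),\dots,(i_{l-1},i_l)$ with $i=i_0<i_1<\dots<i_l=j$; its weight is $\sum_{k=1}^l v_{i_{k-1},i_k}$. $w_{i,j}$ is the maximal weight of a path from $i$ to $j$, with $w_{i,j}=-\infty$ if there is no such path, and $w_{i,i}=0$. Write $x^+=\max(x,0)$. *)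

theory Defs
  imports "HOL-Probability.Probability"
begin

definition edges :: "(int \<times> int) set" where
  "edges = {(i, j). i < j}"

text \<open>A path is given by its list of vertices \<open>i\<^sub>0 < \<dots> < i\<^sub>l\<close>.  The one-vertex list is the
  (only) path from a vertex to itself; it has weight 0.\<close>

definition is_path :: "(int \<times> int \<Rightarrow> bool) \<Rightarrow> int \<Rightarrow> int \<Rightarrow> int list \<Rightarrow> bool" where
  "is_path E i j xs \<longleftrightarrow>
     xs \<noteq> [] \<and> hd xs = i \<and> last xs = j \<and>
     (\<forall>k. Suc k < length xs \<longrightarrow> xs ! k < xs ! Suc k \<and> E (xs ! k, xs ! Suc k))"

definition path_weight :: "(int \<times> int \<Rightarrow> real) \<Rightarrow> int list \<Rightarrow> real" where
  "path_weight u xs = (\<Sum>k<length xs - 1. u (xs ! k, xs ! Suc k))"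

definition max_weight :: "(int \<times> int \<Rightarrow> bool) \<Rightarrow> (int \<times> int \<Rightarrow> real) \<Rightarrow> int \<Rightarrow> int \<Rightarrow> ereal" where
  "max_weight E u i j =
     (if \<exists>xs. is_path E i j xs then ereal (Max (path_weight u ` {xs. is_path E i j xs})) else -\<infinity>)"

lemma is_path_sorted: "is_path E i j xs \<Longrightarrow> sorted_wrt (<) xs"
  unfolding is_path_def by (subst sorted_wrt_iff_nth_Suc_transp) (auto intro: transpI)

text \<open>There are only finitely many paths between two vertices, so the maximum in
  \<open>max_weight\<close> is attained.\<close>

lemma finite_paths: "finite {xs. is_path E i j xs}"
proof (rule finite_subset)
  show "{xs. is_path E i j xs} \<subseteq> {xs. set xs \<subseteq> {i..j} \<and> distinct xs}"
  proof (clarify, intro conjI subsetI)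
    fix xs assume p: "is_path E i j xs"
    then have s: "sorted_wrt (<) xs" by (rule is_path_sorted)
    then show "distinct xs" by (simp add: strict_sorted_iff)
    from s have le: "sorted xs" by (simp add: strict_sorted_iff)
    fix x assume "x \<in> set xs"
    then obtain k where k: "k < length xs" "x = xs ! k" by (auto simp: in_set_conv_nth)
    from p have e: "i = xs ! 0" "j = xs ! (length xs - 1)"
      by (auto simp: is_path_def hd_conv_nth last_conv_nth)
    from k sorted_nth_mono[OF le, of 0 k] sorted_nth_mono[OF le, of k "length xs - 1"]
    show "x \<in> {i..j}" by (simp add: e)
  qed
  show "finite {xs. set xs \<subseteq> {i..j} \<and> distinct xs}"
    by (rule finite_subset_distinct) simp
qed

lemma max_weight_refl: "max_weight E u i i = 0"
proof -
  have "xs = [i]" if p: "is_path E i i xs" for xs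
  proof -
    from p obtain ys where xs: "xs = i # ys" and l: "last xs = i"
      unfolding is_path_def by (metis list.collapse)
    from is_path_sorted[OF p] have less: "\<forall>y\<in>set ys. i < y"
      by (simp add: xs)
    have "ys = []"
    proof (rule ccontr)
      assume "ys \<noteq> []"
      with l have "i \<in> set ys" using last_in_set[of ys] by (simp add: xs)
      with less show False by blast
    qed
    with xs show ?thesis by simp
  qed
  moreover have path: "is_path E i i [i]" by (simp add: is_path_def)
  ultimately have "{xs. is_path E i i xs} = {[i]}" by blast
  moreover from path have "\<exists>xs. is_path E i i xs" by blast
  ultimately show ?thesis
    by (simp add: max_weight_def path_weight_def)
qed

text \<open>The measure \<open>\<nu>\<close> is the law of the generic weight; \<open>law\<close> below forces it to be a Borel
  probability measure on the reals.  The last assumption says that the sigma-algebra generated by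
  all weights is independent of the one generated by the presence of all edges.\<close>

locale weighted_random_digraph = prob_space M
  for M :: "'a measure" +
  fixes p :: real
    and \<nu> :: "real measure"
    and v :: "int \<times> int \<Rightarrow> 'a \<Rightarrow> real"
    and present :: "int \<times> int \<Rightarrow> 'a \<Rightarrow> bool"
  assumes p: "0 < p" "p \<le> 1"
    and indep_weights: "indep_vars (\<lambda>_. borel) v edges"
    and law: "\<And>e. e \<in> edges \<Longrightarrow> distr M borel (v e) = \<nu>"
    and law_pos: "AE x in \<nu>. 0 < x"
    and law_nonconstant: "\<not> (\<exists>c. AE x in \<nu>. x = c)"
    and indep_edges: "indep_events (\<lambda>e. {\<omega> \<in> space M. present e \<omega>}) edges"
    and prob_edge: "\<And>e. e \<in> edges \<Longrightarrow> prob {\<omega> \<in> space M. present e \<omega>} = p"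
    and indep_weights_edges:
      "indep_set
         (sigma_sets (space M) (\<Union>e\<in>edges. {v e -` A \<inter> space M | A. A \<in> sets borel}))
         (sigma_sets (space M) ((\<lambda>e. {\<omega> \<in> space M. present e \<omega>}) ` edges))"
begin

definition w :: "int \<Rightarrow> int \<Rightarrow> 'a \<Rightarrow> ereal" where
  "w i j \<omega> = max_weight (\<lambda>e. present e \<omega>) (\<lambda>e. v e \<omega>) i j"

end

definition converges_in_L1 :: "'a measure \<Rightarrow> (nat \<Rightarrow> 'a \<Rightarrow> real) \<Rightarrow> ('a \<Rightarrow> real) \<Rightarrow> bool" where
  "converges_in_L1 M X Y \<longleftrightarrow>
     (\<forall>n. integrable M (X n)) \<and> integrable M Y \<and>
     (\<lambda>n. \<integral>\<omega>. \<bar>X n \<omega> - Y \<omega>\<bar> \<partial>M) \<longlonglongrightarrow> 0"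

end

theory Submission
  imports Defs "HOL-Real_Asymp.Real_Asymp"
begin

text \<open>Cut the weights off at \<open>K\<close>, and let \<open>B(a, b)\<close> be the maximal cut weight of a path with vertices in
  \<open>[a, b)\<close>. Since a path has at most one edge crossing a given point, \<open>B(a, c) \<le> B(a, b) + B(b, c) + K\<close>,
  so \<open>E B(0, m) / m\<close> converges to some rate, and Hoeffding's inequality for \<open>\<surd>n\<close> independent blocks of
  length \<open>\<surd>n\<close> bounds \<open>B(0, n + 1) / n\<close> from above by the rate. Conversely, any two vertices at
  distance \<open>n\<close> to the power \<open>1/4\<close> within \<open>[0, n]\<close> are eventually joined by a path of two edges, so the
  optimal paths of slightly shortened blocks can be concatenated to a path from \<open>0\<close> to \<open>n\<close>.

  The part of the weights above \<open>K\<close> is removed by \<open>v \<le> min v K + \<epsilon> l + (v - K - \<epsilon> l)\<^sup>+\<close> for an edge of length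
  \<open>l\<close>. Edge lengths sum up to \<open>n\<close> along a path, and the sum of the last terms over all edges in \<open>[0, n]\<close>
  has expectation at most \<open>n E((v - K)\<^sup>+)\<^sup>2 / \<epsilon>\<close>; Chebyshev's inequality along powers of two, after truncation
  at \<open>n\<close>, turns this into an almost sure bound.\<close>

section \<open>Paths and maximal weights\<close>

text \<open>For \<open>p < 1\<close> and \<open>n > 0\<close> the variable \<open>w 0 n\<close> is
  minus infinity with positive probability, so it is not integrable and its superadditivity cannot
  be fed directly into a subadditive ergodic theorem. The maximum over all paths inside a block,
  with default value 0, is always finite, stationary under shifts and, after the cut, bounded by
  \<open>K\<close> times the block length; it yields the rate from both sides.

  The cut caps the crossing edge and makes Hoeffding's inequality applicable. The Hoeffding exponent
  is proportional to the number of blocks whatever their length, so a number of blocks growing like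
  a power of \<open>n\<close> makes the errors summable. The links must be longer than a multiple of
  log \<open>n\<close>, to beat a union bound over about \<open>n^2\<close> pairs, and of smaller
  order than a block.

  The limit \<open>C\<close> is not computed: the lower bound with one cut and the upper bound with
  another concern the same variable, so the rates form a Cauchy sequence in \<open>K\<close>.
  Positivity holds because one additional vertex raises the mean block maximum by at least
  \<open>p\<close> times the mean of the cut weight.\<close>

text \<open>\<open>is_path\<close> without its endpoints. The empty list is allowed, so that cutting
  a list anywhere leaves two chains.\<close>

definition chain :: "(int \<times> int \<Rightarrow> bool) \<Rightarrow> int list \<Rightarrow> bool" where
  "chain E xs \<longleftrightarrow> successively (\<lambda>i j. i < j \<and> E (i, j)) xs"

lemma is_path_iff_chain:
  "is_path E i j xs \<longleftrightarrow> xs \<noteq> [] \<and> hd xs = i \<and> last xs = j \<and> chain E xs"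
  by (simp add: is_path_def chain_def successively_conv_nth)

lemma chain_Nil [simp]: "chain E []"
  and chain_single [simp]: "chain E [x]"
  by (simp_all add: chain_def)

lemma chain_Cons:
  "chain E (x # ys) \<longleftrightarrow> ys = [] \<or> (x < hd ys \<and> E (x, hd ys) \<and> chain E ys)"
  by (auto simp: chain_def successively_Cons)

lemma chain_append_iff:
  "chain E (xs @ ys) \<longleftrightarrow> chain E xs \<and> chain E ys \<and>
     (xs = [] \<or> ys = [] \<or> (last xs < hd ys \<and> E (last xs, hd ys)))"
  by (simp add: chain_def successively_append_iff)

lemma path_weight_Nil [simp]: "path_weight u [] = 0"
  and path_weight_single [simp]: "path_weight u [x] = 0"
  by (simp_all add: path_weight_def)

lemma path_weight_Cons_Cons [simp]:
  "path_weight u (x # y # zs) = u (x, y) + path_weight u (y # zs)"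
  by (simp add: path_weight_def sum.lessThan_Suc_shift del: sum.lessThan_Suc)

lemma path_weight_append:
  assumes "xs \<noteq> []" "ys \<noteq> []"
  shows "path_weight u (xs @ ys) = path_weight u xs + u (last xs, hd ys) + path_weight u ys"
  using assms
proof (induction xs rule: induct_list012)
  case (2 x)
  then show ?case by (cases ys) auto
qed auto

lemma path_weight_mono:
  assumes "\<And>e. u e \<le> u' e"
  shows "path_weight u xs \<le> path_weight u' xs"
  unfolding path_weight_def by (intro sum_mono assms)

lemma path_weight_add:
  "path_weight (\<lambda>e. u e + u' e) xs = path_weight u xs + path_weight u' xs"
  unfolding path_weight_def by (simp add: sum.distrib)

lemma path_weight_cmult: "path_weight (\<lambda>e. c * u e) xs = c * path_weight u xs"
  unfolding path_weight_def by (simp add: sum_distrib_left)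

lemma path_weight_nonneg:
  assumes "\<And>e. 0 \<le> u e"
  shows "0 \<le> path_weight u xs"
  unfolding path_weight_def by (intro sum_nonneg assms)

text \<open>Telescoping; this is why a charge of \<open>\<epsilon> * l\<close> per edge costs only
  \<open>\<epsilon> * n\<close> along a whole path.\<close>

lemma path_weight_length:
  "xs \<noteq> [] \<Longrightarrow> path_weight (\<lambda>(i, j). real_of_int (j - i)) xs = real_of_int (last xs - hd xs)"
  by (induction xs rule: induct_list012) auto

lemma path_weight_bounded:
  assumes "\<And>e. u e \<le> K"
  shows "path_weight u xs \<le> real (length xs - 1) * K"
  using sum_bounded_above[of "{..<length xs - 1}" "\<lambda>k. u (xs ! k, xs ! Suc k)" K] assms
  by (simp add: path_weight_def)

text \<open>Half-open at \<open>b\<close>, so that adjacent blocks share no vertex and hence no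
  edge, which makes their maxima independent.\<close>

definition edges_in :: "int \<Rightarrow> int \<Rightarrow> (int \<times> int) set" where
  "edges_in a b = {(i, j). a \<le> i \<and> i < j \<and> j < b}"

lemma finite_edges_in [simp]: "finite (edges_in a b)"
  by (rule finite_subset[of _ "{a..<b} \<times> {a..<b}"]) (auto simp: edges_in_def)

lemma edges_in_subset_edges: "edges_in a b \<subseteq> edges"
  by (auto simp: edges_in_def edges_def)

text \<open>The candidates do not depend on which edges are present. Presence is tested inside the
  maximum, which therefore ranges over a fixed finite set; locality, measurability and translation
  invariance all rely on this.\<close>

definition increasing_lists :: "int \<Rightarrow> int \<Rightarrow> int list set" where
  "increasing_lists a b = {xs. sorted_wrt (<) xs \<and> set xs \<subseteq> {a..<b}}"

lemma finite_increasing_lists [simp]: "finite (increasing_lists a b)"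
proof (rule finite_subset)
  show "increasing_lists a b \<subseteq> {xs. set xs \<subseteq> {a..<b} \<and> distinct xs}"
    by (auto simp: increasing_lists_def strict_sorted_iff)
  show "finite {xs. set xs \<subseteq> {a..<b} \<and> distinct xs}"
    by (rule finite_subset_distinct) simp
qed

lemma step_in_edges_in:
  assumes "xs \<in> increasing_lists a b" "Suc k < length xs"
  shows "(xs ! k, xs ! Suc k) \<in> edges_in a b"
proof -
  have "xs ! k < xs ! Suc k"
    using assms by (auto simp: increasing_lists_def intro: sorted_wrt_nth_less)
  moreover have "xs ! k \<in> set xs" "xs ! Suc k \<in> set xs"
    using assms(2) by auto
  ultimately show ?thesis
    using assms(1) by (auto simp: increasing_lists_def edges_in_def)
qed

text \<open>The vertices of the list are distinct, so no edge is used twice and the weight is a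
  partial sum of the right-hand side.\<close>

lemma path_weight_le_sum:
  assumes "xs \<in> increasing_lists a b" "\<And>e. e \<in> edges_in a b \<Longrightarrow> 0 \<le> u e"
  shows "path_weight u xs \<le> (\<Sum>e\<in>edges_in a b. u e)"
proof -
  let ?f = "\<lambda>k. (xs ! k, xs ! Suc k)"
  have "inj_on ?f {..<length xs - 1}"
    using assms(1) by (auto simp: inj_on_def increasing_lists_def strict_sorted_iff nth_eq_iff_index_eq)
  then have "path_weight u xs = sum u (?f ` {..<length xs - 1})"
    by (simp add: path_weight_def sum.reindex)
  also have "\<dots> \<le> (\<Sum>e\<in>edges_in a b. u e)"
    by (intro sum_mono2) (auto intro!: step_in_edges_in assms)
  finally show ?thesis .
qed

lemma path_in_increasing_lists:
  assumes "is_path E a b xs"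
  shows "xs \<in> increasing_lists a (b + 1)"
proof -
  have s: "sorted_wrt (<) xs" by (rule is_path_sorted[OF assms])
  have ne: "xs \<noteq> []" and h: "hd xs = a" and l: "last xs = b"
    using assms by (auto simp: is_path_def)
  have "a \<le> x \<and> x \<le> b" if "x \<in> set xs" for x
  proof
    show "a \<le> x" using s that h ne by (cases xs) auto
    have "xs = butlast xs @ [b]" using ne l by (metis append_butlast_last_id)
    then show "x \<le> b" using s that
      by (metis (no_types, lifting) Un_iff append_is_Nil_conv empty_iff insert_iff less_imp_le
          list.set(1) list.set(2) order_refl set_append sorted_wrt_append)
  qed
  with s show ?thesis by (auto simp: increasing_lists_def)
qed

lemma path_weight_mono_edges:
  assumes "xs \<in> increasing_lists a b" "\<And>e. e \<in> edges_in a b \<Longrightarrow> u e \<le> u' e"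
  shows "path_weight u xs \<le> path_weight u' xs"
  unfolding path_weight_def by (intro sum_mono assms(2) step_in_edges_in[OF assms(1)]) simp

text \<open>Absent paths count as 0, and \<open>[]\<close> is always a candidate, so the value is
  the positive part of the maximal weight over \<open>P\<close>, with value 0 if \<open>P\<close>
  contains no path.\<close>

definition opt :: "int list set \<Rightarrow> (int \<times> int \<Rightarrow> bool) \<Rightarrow> (int \<times> int \<Rightarrow> real) \<Rightarrow> real" where
  "opt P E u = Max ((\<lambda>xs. if chain E xs then path_weight u xs else 0) ` insert [] P)"

lemma opt_nonneg:
  assumes "finite P"
  shows "0 \<le> opt P E u"
  unfolding opt_def by (rule Max_ge) (use assms in \<open>auto simp: image_iff\<close>)

lemma path_weight_le_opt:
  assumes "finite P" "xs \<in> P" "chain E xs"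
  shows "path_weight u xs \<le> opt P E u"
  unfolding opt_def by (rule Max_ge) (use assms in \<open>auto simp: image_iff\<close>)

lemma opt_attained:
  assumes "finite P"
  obtains "opt P E u = 0" | xs where "xs \<in> P" "chain E xs" "opt P E u = path_weight u xs"
proof -
  have "opt P E u \<in> (\<lambda>xs. if chain E xs then path_weight u xs else 0) ` insert [] P"
    unfolding opt_def by (rule Max_in) (use assms in auto)
  then show ?thesis
    using that by (auto split: if_splits)
qed

lemma opt_leI:
  assumes "finite P" "0 \<le> c" "\<And>xs. xs \<in> P \<Longrightarrow> chain E xs \<Longrightarrow> path_weight u xs \<le> c"
  shows "opt P E u \<le> c"
  using opt_attained[OF assms(1), of E u] assms(2,3) by metis

lemma opt_mono:
  assumes "finite P" "\<And>e. u e \<le> u' e"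
  shows "opt P E u \<le> opt P E u'"
proof (rule opt_leI[OF assms(1) opt_nonneg[OF assms(1)]])
  fix xs assume "xs \<in> P" "chain E xs"
  then show "path_weight u xs \<le> opt P E u'"
    using path_weight_mono[of u u' xs] path_weight_le_opt[OF assms(1), of xs E u'] assms(2)
    by fastforce
qed

abbreviation best :: "(int \<times> int \<Rightarrow> bool) \<Rightarrow> (int \<times> int \<Rightarrow> real) \<Rightarrow> int \<Rightarrow> int \<Rightarrow> real" where
  "best E u a b \<equiv> opt (increasing_lists a b) E u"

lemma best_le:
  assumes "\<And>e. u e \<le> K" "0 \<le> K" "a \<le> b"
  shows "best E u a b \<le> K * real_of_int (b - a)"
proof (rule opt_leI)
  fix xs assume "xs \<in> increasing_lists a b"
  then have "set xs \<subseteq> {a..<b}" "distinct xs"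
    by (auto simp: increasing_lists_def strict_sorted_iff)
  then have "card (set xs) \<le> card {a..<b}" "card (set xs) = length xs"
    using card_mono[OF finite_atLeastLessThan_int] distinct_card by blast+
  then have "real (length xs - 1) \<le> real_of_int (b - a)"
    using assms(3) by simp
  then have "real (length xs - 1) * K \<le> real_of_int (b - a) * K"
    using assms(2) by (rule mult_right_mono)
  then show "path_weight u xs \<le> K * real_of_int (b - a)"
    using path_weight_bounded[of u K xs] assms(1) by (simp add: mult.commute)
qed (use assms in auto)

lemma best_split:
  assumes "\<And>e. u e \<le> K" "0 \<le> K" "a \<le> b" "b \<le> c"
  shows "best E u a c \<le> best E u a b + best E u b c + K"
proof (rule opt_leI)
  have nonneg: "0 \<le> best E u a b" "0 \<le> best E u b c" by (auto intro: opt_nonneg)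
  with assms(2) show "0 \<le> best E u a b + best E u b c + K" by simp
  fix xs assume xs: "xs \<in> increasing_lists a c" and ch: "chain E xs"
  define ys where "ys = takeWhile (\<lambda>x. x < b) xs"
  define zs where "zs = dropWhile (\<lambda>x. x < b) xs"
  have xs_eq: "xs = ys @ zs" by (simp add: ys_def zs_def)
  have sorted: "sorted_wrt (<) ys" "sorted_wrt (<) zs"
    using xs by (auto simp: increasing_lists_def xs_eq sorted_wrt_append)
  have ys: "ys \<in> increasing_lists a b"
    using xs sorted set_takeWhileD[of _ "\<lambda>x. x < b" xs]
    by (fastforce simp: increasing_lists_def ys_def)
  have "b \<le> z" if "z \<in> set zs" for z
  proof (cases zs)
    case (Cons z' zs')
    then have "b \<le> z'" using hd_dropWhile[of "\<lambda>x. x < b" xs] by (simp add: zs_def)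
    with Cons sorted(2) that show ?thesis by auto
  qed (use that in simp)
  then have zs: "zs \<in> increasing_lists b c"
    using xs sorted by (auto simp: increasing_lists_def xs_eq)
  have chains: "chain E ys" "chain E zs"
    using ch by (auto simp: xs_eq chain_append_iff)
  have "path_weight u ys \<le> best E u a b" "path_weight u zs \<le> best E u b c"
    by (intro path_weight_le_opt finite_increasing_lists ys zs chains)+
  \<comment> \<open>Only the edge from \<open>last ys\<close> to \<open>hd zs\<close> is lost. If
    one of the parts is empty there is no such edge, and \<open>0 \<le> K\<close> covers the
    surplus.\<close>
  moreover have "path_weight u xs \<le> path_weight u ys + K + path_weight u zs"
    using assms(1)[of "(last ys, hd zs)"] assms(2)
    by (cases "ys = []"; cases "zs = []") (simp_all add: xs_eq path_weight_append)
  ultimately show "path_weight u xs \<le> best E u a b + best E u b c + K" by simp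
qed simp

lemma best_blocks:
  assumes "\<And>e. u e \<le> K" "0 \<le> K"
  shows "best E u 0 (int (N * m)) \<le>
    (\<Sum>k<N. best E u (int (k * m)) (int (k * m + m))) + real N * K"
proof (induction N)
  case 0
  then show ?case using best_le[OF assms, of 0 0 E] by simp
next
  case (Suc N)
  have "best E u 0 (int (Suc N * m)) \<le>
      best E u 0 (int (N * m)) + best E u (int (N * m)) (int (Suc N * m)) + K"
    by (rule best_split[OF assms]) auto
  with Suc show ?case by (simp add: algebra_simps)
qed

lemma best_mono_interval:
  assumes "a' \<le> a" "b \<le> b'"
  shows "best E u a b \<le> best E u a' b'"
proof (rule opt_leI[OF finite_increasing_lists opt_nonneg[OF finite_increasing_lists]])
  fix xs assume "xs \<in> increasing_lists a b" "chain E xs"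
  moreover from this(1) have "xs \<in> increasing_lists a' b'"
    using assms by (fastforce simp: increasing_lists_def)
  ultimately show "path_weight u xs \<le> best E u a' b'"
    by (intro path_weight_le_opt) auto
qed

section \<open>Concatenation of block paths through two-edge links\<close>

definition joins :: "(int \<times> int \<Rightarrow> bool) \<Rightarrow> int \<Rightarrow> int \<Rightarrow> bool" where
  "joins E i j \<longleftrightarrow> (\<exists>z\<in>{i<..<j}. E (i, z) \<and> E (z, j))"

text \<open>Block \<open>k\<close> contributes an optimal path of its part from
  \<open>k * m + g\<close> on. The path built so far ends at some \<open>t \<le> N * m\<close>, so
  the next piece starts at distance at least \<open>g\<close> and a link exists; weights are
  nonnegative, so links only add. The bound on \<open>t\<close> is not strict because the
  construction starts at 0 with no block.\<close>

lemma best_blocks_le_path: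
  assumes u: "\<And>e. 0 \<le> u e"
    and joins: "\<And>i j. 0 \<le> i \<Longrightarrow> i + int g \<le> j \<Longrightarrow> j \<le> int n \<Longrightarrow> joins E i j"
    and "g < m"
  shows "N * m \<le> n \<Longrightarrow> \<exists>xs t. is_path E 0 t xs \<and> t \<le> int (N * m) \<and>
    (\<Sum>k<N. best E u (int (k * m + g)) (int (k * m + m))) \<le> path_weight u xs"
proof (induction N)
  case 0
  show ?case by (rule exI[of _ "[0]"], rule exI[of _ 0]) (simp add: is_path_iff_chain)
next
  case (Suc N)
  then obtain xs t where xs: "is_path E 0 t xs" and t: "t \<le> int (N * m)"
    and le: "(\<Sum>k<N. best E u (int (k * m + g)) (int (k * m + m))) \<le> path_weight u xs"
    by auto
  have t0: "0 \<le> t"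
    using path_in_increasing_lists[OF xs] xs
    by (auto simp: increasing_lists_def is_path_def dest: last_in_set)
  let ?a = "int (N * m + g)" and ?b = "int (N * m + m)"
  \<comment> \<open>An optimum of 0 may come from the default value or from the empty list. The
    singleton \<open>[?a]\<close> then serves as a path of weight 0; it lies in the block because
    \<open>g < m\<close>.\<close>
  obtain ys where ys: "ys \<noteq> []" "ys \<in> increasing_lists ?a ?b" "chain E ys"
    "best E u ?a ?b \<le> path_weight u ys"
  proof (cases rule: opt_attained[OF finite_increasing_lists[of ?a ?b], of E u])
    case 1
    then show ?thesis
      using that[of "[?a]"] \<open>g < m\<close> by (auto simp: increasing_lists_def)
  next
    case (2 ys)
    then show ?thesis
      using that[of "[?a]"] that[of ys] \<open>g < m\<close> by (cases ys) (auto simp: increasing_lists_def)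
  qed
  have h: "?a \<le> hd ys" "hd ys < ?b" "last ys < ?b"
    using ys(1,2) hd_in_set[of ys] last_in_set[of ys] by (auto simp: increasing_lists_def subset_iff)
  have "?b \<le> int n" using Suc.prems by (simp only: of_nat_le_iff) simp
  then have "joins E t (hd ys)"
    using t t0 h by (intro joins) auto
  then obtain z where z: "t < z" "z < hd ys" "E (t, z)" "E (z, hd ys)"
    by (auto simp: joins_def)
  let ?xs = "xs @ [z] @ ys"
  have "is_path E 0 (last ys) ?xs"
    using xs ys z by (auto simp: is_path_iff_chain chain_append_iff chain_Cons)
  moreover have "path_weight u ?xs = path_weight u xs + u (t, z) + u (z, hd ys) + path_weight u ys"
    using xs ys(1) path_weight_append[of "[z]" ys u]
    by (simp add: is_path_iff_chain path_weight_append)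
  then have "path_weight u xs + path_weight u ys \<le> path_weight u ?xs"
    using u[of "(t, z)"] u[of "(z, hd ys)"] by simp
  ultimately show ?case
    using le ys(4) h(3) by (intro exI[of _ ?xs] exI[of _ "last ys"]) (auto simp: algebra_simps)
qed

text \<open>One further link leads from the end of the concatenated path to \<open>n\<close>; the
  space \<open>g\<close> after the last block is reserved for it.\<close>

lemma best_blocks_le_path_to:
  assumes u: "\<And>e. 0 \<le> u e"
    and joins: "\<And>i j. 0 \<le> i \<Longrightarrow> i + int g \<le> j \<Longrightarrow> j \<le> int n \<Longrightarrow> joins E i j"
    and "g < m" "N * m + g \<le> n"
  shows "\<exists>xs. is_path E 0 (int n) xs \<and>
    (\<Sum>k<N. best E u (int (k * m + g)) (int (k * m + m))) \<le> path_weight u xs"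
proof -
  obtain xs t where xs: "is_path E 0 t xs" and t: "t \<le> int (N * m)"
    and le: "(\<Sum>k<N. best E u (int (k * m + g)) (int (k * m + m))) \<le> path_weight u xs"
    using best_blocks_le_path[where u = u and g = g and m = m and n = n and N = N, OF assms(1-3)] assms(4)
    by auto
  have t0: "0 \<le> t"
    using path_in_increasing_lists[OF xs] xs
    by (auto simp: increasing_lists_def is_path_def dest: last_in_set)
  have "int (N * m + g) \<le> int n" using assms(4) by (simp only: of_nat_le_iff)
  then have "joins E t (int n)"
    using t t0 by (intro joins) auto
  then obtain z where z: "t < z" "z < int n" "E (t, z)" "E (z, int n)"
    by (auto simp: joins_def)
  let ?xs = "xs @ [z, int n]"
  have "is_path E 0 (int n) ?xs"
    using xs z by (auto simp: is_path_iff_chain chain_append_iff chain_Cons)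
  moreover have "path_weight u ?xs = path_weight u xs + u (t, z) + u (z, int n)"
    using xs by (simp add: is_path_iff_chain path_weight_append)
  then have "path_weight u xs \<le> path_weight u ?xs"
    using u[of "(t, z)"] u[of "(z, int n)"] by simp
  ultimately show ?thesis using le by force
qed

section \<open>Independence and stationarity of the environment\<close>

text \<open>The weights are positive only almost surely. Cutting also below at 0 makes every
  deterministic path estimate valid at all sample points.\<close>

definition cut :: "real \<Rightarrow> real \<Rightarrow> real" where
  "cut K x = max 0 (min x K)"

lemma cut_nonneg [simp]: "0 \<le> cut K x"
  and cut_le: "0 \<le> K \<Longrightarrow> cut K x \<le> K"
  and cut_le_self: "0 \<le> x \<Longrightarrow> cut K x \<le> x"
  and cut_mono: "K \<le> L \<Longrightarrow> cut K x \<le> cut L x"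
  by (auto simp: cut_def max_def min_def)

lemma borel_measurable_cut [measurable]: "cut K \<in> borel_measurable borel"
  unfolding cut_def by measurable

text \<open>An environment \<open>y\<close> carries the weight of \<open>e\<close> at \<open>Inl e\<close> and the indicator of the
  presence of \<open>e\<close> at \<open>Inr e\<close>.\<close>

type_synonym env = "(int \<times> int) + (int \<times> int) \<Rightarrow> real"

text \<open>\<open>opt\<close> as a function on a product space of real coordinates, so that
  independence and equality in law can be applied to it as a Borel function of finitely many
  coordinates.\<close>

definition opt_env :: "int list set \<Rightarrow> real \<Rightarrow> env \<Rightarrow> real" where
  "opt_env P K y = opt P (\<lambda>e. y (Inr e) = 1) (\<lambda>e. cut K (y (Inl e)))"

definition env_in :: "int \<Rightarrow> int \<Rightarrow> ((int \<times> int) + (int \<times> int)) set" where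
  "env_in a b = edges_in a b <+> edges_in a b"

lemma env_in_iff [simp]: "Inl e \<in> env_in a b \<longleftrightarrow> e \<in> edges_in a b" "Inr e \<in> env_in a b \<longleftrightarrow> e \<in> edges_in a b"
  by (auto simp: env_in_def)

lemma env_in_subset: "env_in a b \<subseteq> edges <+> edges"
  using edges_in_subset_edges by (auto simp: env_in_def)

lemma chain_iff_steps:
  assumes "sorted_wrt (<) xs"
  shows "chain E xs \<longleftrightarrow> (\<forall>k<length xs - 1. E (xs ! k, xs ! Suc k))"
  using assms sorted_wrt_nth_less[of "(<)" xs]
  by (auto simp: chain_def successively_conv_nth)

lemma opt_env_cong:
  assumes "P \<subseteq> increasing_lists a b" "\<And>i. i \<in> env_in a b \<Longrightarrow> y i = y' i"
  shows "opt_env P K y = opt_env P K y'"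
proof -
  have "chain (\<lambda>e. y (Inr e) = 1) xs = chain (\<lambda>e. y' (Inr e) = 1) xs \<and>
      path_weight (\<lambda>e. cut K (y (Inl e))) xs = path_weight (\<lambda>e. cut K (y' (Inl e))) xs"
    if "xs \<in> insert [] P" for xs
  proof (cases "xs = []")
    case False
    with that assms(1) have xs: "xs \<in> increasing_lists a b" by auto
    then have "y (Inr (xs ! k, xs ! Suc k)) = y' (Inr (xs ! k, xs ! Suc k))"
      "y (Inl (xs ! k, xs ! Suc k)) = y' (Inl (xs ! k, xs ! Suc k))" if "k < length xs - 1" for k
      using that by (auto intro!: assms(2) step_in_edges_in)
    then show ?thesis
      using xs by (simp add: chain_iff_steps increasing_lists_def path_weight_def)
  qed simp
  then show ?thesis
    unfolding opt_env_def opt_def by (intro arg_cong[where f = Max] image_cong) auto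
qed

lemma opt_env_restrict:
  assumes "P \<subseteq> increasing_lists a b"
  shows "opt_env P K (restrict y (env_in a b)) = opt_env P K y"
  using assms by (rule opt_env_cong) simp

lemma opt_env_measurable:
  assumes "P \<subseteq> increasing_lists a b" "env_in a b \<subseteq> J"
  shows "opt_env P K \<in> borel_measurable (PiM J (\<lambda>_. borel))"
proof -
  let ?N = "PiM J (\<lambda>_. borel :: real measure)"
  have "(\<lambda>y. if chain (\<lambda>e. y (Inr e) = 1) xs then path_weight (\<lambda>e. cut K (y (Inl e))) xs else 0)
      \<in> borel_measurable ?N" if "xs \<in> insert [] P" for xs
  proof (cases "xs = []")
    case False
    with that assms(1) have xs: "xs \<in> increasing_lists a b" by auto
    have 1 [measurable]: "(\<lambda>y. y (Inr (xs ! k, xs ! Suc k))) \<in> borel_measurable ?N"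
      "(\<lambda>y. y (Inl (xs ! k, xs ! Suc k))) \<in> borel_measurable ?N" if "k < length xs - 1" for k
      using that assms(2) xs
      by (auto intro!: measurable_component_singleton subsetD[OF assms(2)] step_in_edges_in)
    have sorted: "sorted_wrt (<) xs" using xs by (simp add: increasing_lists_def)
    have "Measurable.pred ?N (\<lambda>y. \<forall>k\<in>{..<length xs - 1}. y (Inr (xs ! k, xs ! Suc k)) = 1)"
      by (intro pred_intros_finite) (auto intro!: pred_eq_const1 1)
    then have [measurable]: "Measurable.pred ?N (\<lambda>y. chain (\<lambda>e. y (Inr e) = 1) xs)"
      by (simp add: chain_iff_steps[OF sorted] Ball_def)
    have [measurable]: "(\<lambda>y. path_weight (\<lambda>e. cut K (y (Inl e))) xs) \<in> borel_measurable ?N"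
      unfolding path_weight_def by (intro borel_measurable_sum) (simp, measurable)
    show ?thesis by measurable
  qed simp
  moreover have "finite (insert [] P)"
    using assms(1) finite_increasing_lists finite_subset by blast
  ultimately show ?thesis
    unfolding opt_env_def[abs_def] opt_def by (intro borel_measurable_Max)
qed

section \<open>Translations, and functions of independent families\<close>

definition shift_edge :: "int \<Rightarrow> int \<times> int \<Rightarrow> int \<times> int" where
  "shift_edge a e = (fst e + a, snd e + a)"

lemma inj_shift_edge: "inj (shift_edge a)"
  by (auto simp: inj_on_def shift_edge_def prod_eq_iff)

lemma shift_edge_mem [simp]: "shift_edge a e \<in> edges \<longleftrightarrow> e \<in> edges"
  by (cases e) (auto simp: shift_edge_def edges_def)

lemma path_weight_map: "path_weight u (map (\<lambda>x. x + a) xs) = path_weight (\<lambda>e. u (shift_edge a e)) xs"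
  by (simp add: path_weight_def shift_edge_def)

lemma chain_map: "chain E (map (\<lambda>x. x + a) xs) \<longleftrightarrow> chain (\<lambda>e. E (shift_edge a e)) xs"
  by (simp add: chain_def shift_edge_def successively_map)

lemma increasing_lists_shift:
  "increasing_lists (c + a) (d + a) = map (\<lambda>x. x + a) ` increasing_lists c d"
proof (intro equalityI subsetI)
  fix xs assume xs: "xs \<in> increasing_lists (c + a) (d + a)"
  have "map (\<lambda>x. x - a) xs \<in> increasing_lists c d"
    using xs by (auto simp: increasing_lists_def sorted_wrt_map)
  moreover have "xs = map (\<lambda>x. x + a) (map (\<lambda>x. x - a) xs)"
    by (simp add: o_def)
  ultimately show "xs \<in> map (\<lambda>x. x + a) ` increasing_lists c d" by blast
qed (auto simp: increasing_lists_def sorted_wrt_map subset_iff)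

lemma best_shift:
  "best E u (c + a) (d + a) = best (\<lambda>e. E (shift_edge a e)) (\<lambda>e. u (shift_edge a e)) c d"
proof -
  have "insert [] (increasing_lists (c + a) (d + a)) = map (\<lambda>x. x + a) ` insert [] (increasing_lists c d)"
    by (simp add: increasing_lists_shift)
  then show ?thesis
    unfolding opt_def by (simp only: image_image path_weight_map chain_map)
qed

text \<open>Applied to the maxima of disjoint blocks, to the two-edge links through different middle
  vertices, to the separation of a new edge from the past, and to relabelled families.\<close>

lemma (in prob_space) indep_vars_on_blocks:
  fixes X :: "'i \<Rightarrow> 'a \<Rightarrow> real"
  assumes "indep_vars (\<lambda>_. borel) X I" "\<And>j. j \<in> L \<Longrightarrow> K j \<subseteq> I" "disjoint_family_on K L"
    and "\<And>j. j \<in> L \<Longrightarrow> F j \<in> borel_measurable (PiM (K j) (\<lambda>_. borel))"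
  shows "indep_vars (\<lambda>_. borel) (\<lambda>j \<omega>. F j (\<lambda>i\<in>K j. X i \<omega>) :: real) L"
  by (rule indep_vars_compose2[OF indep_vars_restrict[OF assms(1-3)] assms(4)])

text \<open>The joint law of an independent family is the product of its marginals, so an injective
  relabelling that preserves the marginals preserves the joint law. This is the source of
  stationarity.\<close>

lemma (in prob_space) indep_vars_expectation_reindex:
  fixes X :: "'i \<Rightarrow> 'a \<Rightarrow> real"
  assumes ind: "indep_vars (\<lambda>_. borel) X I" and "J \<subseteq> I" "s ` J \<subseteq> I" "inj_on s J"
    and law: "\<And>i. i \<in> J \<Longrightarrow> distr M borel (X (s i)) = distr M borel (X i)"
    and F: "F \<in> borel_measurable (PiM J (\<lambda>_. borel))"
  shows "expectation (\<lambda>\<omega>. F (\<lambda>i\<in>J. X (s i) \<omega>) :: real) = expectation (\<lambda>\<omega>. F (\<lambda>i\<in>J. X i \<omega>))"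
proof (cases "J = {}")
  case False
  have rv: "random_variable borel (X i)" if "i \<in> I" for i
    using ind that by (simp add: indep_vars_def)
  have rvs: "random_variable borel (X (s i))" "random_variable borel (X i)" if "i \<in> J" for i
    using that assms(2,3) by (intro rv; blast)+
  have ind1: "indep_vars (\<lambda>_. borel) X J"
    by (rule indep_vars_subset[OF ind \<open>J \<subseteq> I\<close>])
  \<comment> \<open>The relabelled family is the case of singleton blocks \<open>{s j}\<close>,
    which are disjoint by injectivity of \<open>s\<close>.\<close>
  have "indep_vars (\<lambda>_. borel) (\<lambda>j \<omega>. (\<lambda>f. f (s j)) (\<lambda>i\<in>{s j}. X i \<omega>)) J"
    using \<open>s ` J \<subseteq> I\<close> \<open>inj_on s J\<close>
    by (intro indep_vars_on_blocks[OF ind])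
       (auto simp: disjoint_family_on_def inj_on_def intro!: measurable_component_singleton)
  then have ind2: "indep_vars (\<lambda>_. borel) (\<lambda>i. X (s i)) J" by simp
  have m1: "(\<lambda>\<omega>. \<lambda>i\<in>J. X i \<omega>) \<in> measurable M (PiM J (\<lambda>_. borel))"
    and m2: "(\<lambda>\<omega>. \<lambda>i\<in>J. X (s i) \<omega>) \<in> measurable M (PiM J (\<lambda>_. borel))"
    by (intro measurable_restrict rvs(2), assumption) (intro measurable_restrict rvs(1))
  have "distr M (PiM J (\<lambda>_. borel)) (\<lambda>\<omega>. \<lambda>i\<in>J. X (s i) \<omega>)
      = PiM J (\<lambda>i. distr M borel (X (s i)))"
    using indep_vars_iff_distr_eq_PiM'[of J "\<lambda>i. X (s i)" "\<lambda>_. borel"] False rvs ind2 by auto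
  also have "\<dots> = PiM J (\<lambda>i. distr M borel (X i))"
    by (rule PiM_cong) (auto simp: law)
  also have "\<dots> = distr M (PiM J (\<lambda>_. borel)) (\<lambda>\<omega>. \<lambda>i\<in>J. X i \<omega>)"
    using indep_vars_iff_distr_eq_PiM'[of J X "\<lambda>_. borel"] False rvs ind1 by auto
  finally show ?thesis
    using integral_distr[OF m1 F] integral_distr[OF m2 F] by simp
qed (simp add: restrict_def)

section \<open>Weights and edge indicators as one independent family\<close>

context weighted_random_digraph
begin

definition X :: "(int \<times> int) + (int \<times> int) \<Rightarrow> 'a \<Rightarrow> real" where
  "X = case_sum v (\<lambda>e \<omega>. of_bool (present e \<omega>))"

lemma X_simps [simp]: "X (Inl e) = v e" "X (Inr e) = (\<lambda>\<omega>. of_bool (present e \<omega>))"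
  by (simp_all add: X_def)

lemma v_measurable: "e \<in> edges \<Longrightarrow> random_variable borel (v e)"
  using indep_weights by (simp add: indep_vars_def)

lemma present_event: "e \<in> edges \<Longrightarrow> {\<omega> \<in> space M. present e \<omega>} \<in> events"
  using indep_edges by (auto simp: indep_events_def)

lemma X_measurable: "i \<in> edges <+> edges \<Longrightarrow> random_variable borel (X i)"
  using v_measurable present_event by (auto simp: Plus_def intro!: borel_measurable_if)

text \<open>A finite intersection splits into a weight event and a presence event. The product rule
  holds between the two by \<open>indep_weights_edges\<close>, and within each by the independence
  of the respective family.\<close>

lemma indep_X: "indep_vars (\<lambda>_. borel) X (edges <+> edges)"
  unfolding indep_vars_def2
proof (intro conjI ballI indep_setsI)
  let ?P = "\<lambda>e. {\<omega> \<in> space M. present e \<omega>}"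
  let ?S = "\<lambda>i. {X i -` A \<inter> space M |A. A \<in> sets borel}"
  show "random_variable borel (X i)" if "i \<in> edges <+> edges" for i
    by (rule X_measurable[OF that])
  then show "?S i \<subseteq> events" if "i \<in> edges <+> edges" for i
    using that by (auto intro: measurable_sets)
  \<comment> \<open>A single event is trivially closed under intersection, so the independence of
    the events passes to the sigma-algebras they generate. These contain every preimage under an
    indicator.\<close>
  have indP: "indep_sets (\<lambda>e. sigma_sets (space M) {?P e}) edges"
    by (rule indep_sets_sigma) (use indep_edges in \<open>auto simp: indep_events_def_alt Int_stable_def\<close>)
  have indV: "indep_sets (\<lambda>e. {v e -` A \<inter> space M |A. A \<in> sets borel}) edges"
    using indep_weights by (simp add: indep_vars_def2)
  have vim: "X (Inr e) -` B \<inter> space M \<in> sigma_sets (space M) {?P e}" for e B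
  proof -
    have "X (Inr e) -` B \<inter> space M =
      (if 1 \<in> B then if 0 \<in> B then space M else ?P e else if 0 \<in> B then space M - ?P e else {})"
      by (auto simp: of_bool_def split: if_splits)
    then show ?thesis
      by (auto intro: sigma_sets.intros sigma_sets_top)
  qed
  let ?SV = "sigma_sets (space M) (\<Union>e\<in>edges. {v e -` A \<inter> space M | A. A \<in> sets borel})"
  let ?SP = "sigma_sets (space M) (?P ` edges)"
  fix A J assume J: "J \<subseteq> edges <+> edges" "finite J" "J \<noteq> {}" and A: "\<forall>i\<in>J. A i \<in> ?S i"
  define J1 where "J1 = Inl -` J"
  define J2 where "J2 = Inr -` J"
  have J_eq: "J = Inl ` J1 \<union> Inr ` J2"
  proof (rule set_eqI)
    fix i show "i \<in> J \<longleftrightarrow> i \<in> Inl ` J1 \<union> Inr ` J2" by (cases i) (auto simp: J1_def J2_def)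
  qed
  have fin: "finite J1" "finite J2"
    unfolding J1_def J2_def by (simp_all add: finite_vimageI[OF J(2)])
  have sub: "J1 \<subseteq> edges" "J2 \<subseteq> edges"
    using J(1) unfolding J1_def J2_def by blast+
  have A1: "A (Inl e) \<in> {v e -` A \<inter> space M |A. A \<in> sets borel}" if "e \<in> J1" for e
    using bspec[OF A, of "Inl e"] that by (simp add: J1_def)
  have A2: "A (Inr e) \<in> sigma_sets (space M) {?P e}" if "e \<in> J2" for e
  proof -
    have "Inr e \<in> J" using that by (simp add: J2_def)
    from bspec[OF A this] obtain C where "A (Inr e) = X (Inr e) -` C \<inter> space M"
      unfolding mem_Collect_eq by (elim exE conjE)
    then show ?thesis using vim[of e C] by (simp only:)
  qed
  \<comment> \<open>Intersecting with \<open>space M\<close> gives an event of probability 1 when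
    \<open>J1\<close> is empty, in agreement with the empty product; likewise for \<open>b\<close>
    and \<open>J2\<close>.\<close>
  define a where "a = (\<Inter>e\<in>J1. A (Inl e)) \<inter> space M"
  define b where "b = (\<Inter>e\<in>J2. A (Inr e)) \<inter> space M"
  have A1': "A (Inl e) \<in> ?SV" if "e \<in> J1" for e
    using A1[OF that] sub that by (intro sigma_sets.Basic) auto
  have A2': "A (Inr e) \<in> ?SP" if "e \<in> J2" for e
  proof -
    have "{?P e} \<subseteq> ?P ` edges" using sub that by blast
    from subsetD[OF sigma_sets_mono'[OF this] A2[OF that]] show ?thesis .
  qed
  have fin_Int: "(\<Inter>e\<in>K. B e) \<inter> space M \<in> sigma_sets (space M) G"
    if "G \<subseteq> Pow (space M)" "finite K" "\<And>e. e \<in> K \<Longrightarrow> B e \<in> sigma_sets (space M) G"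
    for G K and B :: "int \<times> int \<Rightarrow> 'a set"
  proof -
    interpret sigma_algebra "space M" "sigma_sets (space M) G"
      using that(1) by (rule sigma_algebra_sigma_sets)
    show ?thesis
    proof (cases "K = {}")
      case False
      with that(2,3) have "(\<Inter>e\<in>K. B e) \<in> sigma_sets (space M) G"
        by (intro finite_INT) auto
      then show ?thesis using top by (rule Int)
    qed simp
  qed
  have aS: "a \<in> ?SV"
    unfolding a_def using fin A1' by (intro fin_Int) auto
  have bS: "b \<in> ?SP"
    unfolding b_def using fin A2' by (intro fin_Int) auto
  have pa: "prob a = (\<Prod>e\<in>J1. prob (A (Inl e)))"
  proof (cases "J1 = {}")
    case False
    have "A (Inl e) \<subseteq> space M" if "e \<in> J1" for e using A1[OF that] by auto
    then have "a = (\<Inter>e\<in>J1. A (Inl e))" unfolding a_def using False by auto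
    then show ?thesis using indep_setsD[OF indV sub(1) False fin(1)] A1 by simp
  qed (simp add: a_def prob_space)
  have pb: "prob b = (\<Prod>e\<in>J2. prob (A (Inr e)))"
  proof (cases "J2 = {}")
    case False
    have "A (Inr e) \<subseteq> space M" if "e \<in> J2" for e
      using sigma_sets_into_sp[OF _ A2[OF that]] by auto
    then have "b = (\<Inter>e\<in>J2. A (Inr e))" unfolding b_def using False by auto
    then show ?thesis using indep_setsD[OF indP sub(2) False fin(2)] A2 by simp
  qed (simp add: b_def prob_space)
  have "A i \<subseteq> space M" if "i \<in> J" for i using A that by auto
  then have "(\<Inter>i\<in>J. A i) = a \<inter> b"
    using J(3) unfolding a_def b_def J_eq by (auto simp: image_iff) blast+
  then have "prob (\<Inter>i\<in>J. A i) = prob a * prob b"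
    using indep_setD[OF indep_weights_edges aS bS] by simp
  also have "\<dots> = (\<Prod>i\<in>J. prob (A i))"
    unfolding pa pb J_eq using fin by (subst prod.union_disjoint) (auto simp: prod.reindex)
  finally show "prob (\<Inter>i\<in>J. A i) = (\<Prod>i\<in>J. prob (A i))" .
qed

end

section \<open>Block maxima\<close>

text \<open>Fekete's lemma: the limit is the infimum of the quotients, which is finite because they
  are bounded below by 0. Division with remainder by an almost optimal \<open>m\<close> gives the
  upper bound.\<close>

lemma fekete:
  fixes f :: "nat \<Rightarrow> real"
  assumes sub: "\<And>m n. f (m + n) \<le> f m + f n" and nonneg: "\<And>n. 0 \<le> f n"
  shows "convergent (\<lambda>n. f n / real n)"
proof -
  define L where "L = Inf ((\<lambda>n. f n / real n) ` {1..})"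
  have bdd: "bdd_below ((\<lambda>n. f n / real n) ` {1..})"
    by (rule bdd_belowI[of _ 0]) (auto simp: nonneg)
  have lower: "L \<le> f n / real n" if "n \<ge> 1" for n
    unfolding L_def using that by (intro cINF_lower bdd) auto
  have mult: "f (q * m + r) \<le> real q * f m + f r" for q m r
  proof (induction q)
    case (Suc q)
    have "f (Suc q * m + r) = f (m + (q * m + r))" by (simp add: algebra_simps)
    with sub[of m "q * m + r"] Suc show ?case by (simp add: algebra_simps)
  qed simp
  have "(\<lambda>n. f n / real n) \<longlonglongrightarrow> L"
  proof (rule order_tendstoI)
    fix a assume "a < L"
    then show "\<forall>\<^sub>F n in sequentially. a < f n / real n"
      using lower by (intro eventually_sequentiallyI[of 1]) force
  next
    fix a assume a: "L < a"
    define c where "c = (L + a) / 2"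
    have c: "L < c" "c < a" using a by (auto simp: c_def)
    obtain m where m: "m \<ge> 1" "f m / real m < c"
      using cINF_less_iff[OF _ bdd, of c] c(1) unfolding L_def by auto
    \<comment> \<open>Bounds \<open>f r\<close> for all remainders \<open>r < m\<close> at once, by
      \<open>f r \<le> r * f 1 + f 0\<close>.\<close>
    define D where "D = real m * f 1 + f 0"
    have "f n / real n \<le> c + D / real n" if "n \<ge> 1" for n
    proof -
      have "f n \<le> real (n div m) * f m + f (n mod m)"
        using mult[of "n div m" m "n mod m"] by simp
      moreover have "real (n div m) * f m \<le> real n / real m * f m"
        by (intro mult_right_mono nonneg of_nat_div_le_of_nat)
      moreover have "real n * (f m / real m) \<le> real n * c"
        using m(2) by (intro mult_left_mono) auto
      then have "real n / real m * f m \<le> real n * c" by simp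
      moreover have "f (n mod m) \<le> D"
      proof -
        have "f (n mod m) \<le> real (n mod m) * f 1 + f 0" using mult[of "n mod m" 1 0] by simp
        also have "\<dots> \<le> D" unfolding D_def
          using m(1) by (intro add_right_mono mult_right_mono nonneg) (simp add: less_imp_le)
        finally show ?thesis .
      qed
      ultimately have "f n \<le> real n * c + D" by linarith
      with that show ?thesis by (simp add: field_simps)
    qed
    moreover have "(\<lambda>n. c + D / real n) \<longlonglongrightarrow> c" by real_asymp
    then have "\<forall>\<^sub>F n in sequentially. c + D / real n < a"
      using c(2) by (rule order_tendstoD)
    then have "\<forall>\<^sub>F n in sequentially. 1 \<le> n \<and> c + D / real n < a"
      by (intro eventually_conj eventually_ge_at_top)
    ultimately show "\<forall>\<^sub>F n in sequentially. f n / real n < a"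
      by (elim eventually_mono) (metis le_less_trans)
  qed
  then show ?thesis by (rule convergentI)
qed

lemma (in prob_space) borel_cantelli_prob:
  assumes "\<And>n. A n \<in> events" "\<And>n. prob (A n) \<le> f n" "summable f"
  shows "AE \<omega> in M. \<forall>\<^sub>F n in sequentially. \<omega> \<notin> A n"
proof -
  have "summable (\<lambda>n. prob (A n))"
    using assms(2) by (intro summable_comparison_test'[OF assms(3)]) auto
  then have "AE \<omega> in M. \<forall>\<^sub>F n in sequentially. \<omega> \<in> space M - A n"
    by (intro borel_cantelli_AE1 assms(1)) (simp_all add: emeasure_eq_measure)
  then show ?thesis
    by (rule AE_mp) (auto elim: eventually_mono intro!: AE_I2)
qed

section \<open>Mean block maxima, their rate and their concentration\<close>

context weighted_random_digraph
begin

definition block_max :: "real \<Rightarrow> int \<Rightarrow> int \<Rightarrow> 'a \<Rightarrow> real" where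
  "block_max K a b \<omega> = best (\<lambda>e. present e \<omega>) (\<lambda>e. cut K (v e \<omega>)) a b"

lemma opt_eq_opt_env:
  assumes "P \<subseteq> increasing_lists a b"
  shows "opt P (\<lambda>e. present e \<omega>) (\<lambda>e. cut K (v e \<omega>)) = opt_env P K (\<lambda>i\<in>env_in a b. X i \<omega>)"
  by (subst opt_env_restrict[OF assms]) (simp add: opt_env_def)

lemma block_max_eq_opt_env: "block_max K a b \<omega> = opt_env (increasing_lists a b) K (\<lambda>i\<in>env_in a b. X i \<omega>)"
  unfolding block_max_def by (rule opt_eq_opt_env) simp

lemma X_restrict_measurable:
  "J \<subseteq> edges <+> edges \<Longrightarrow> (\<lambda>\<omega>. \<lambda>i\<in>J. X i \<omega>) \<in> measurable M (PiM J (\<lambda>_. borel))"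
  by (intro measurable_restrict X_measurable) blast

lemma block_max_measurable [measurable]: "random_variable borel (block_max K a b)"
  unfolding block_max_eq_opt_env
  by (rule measurable_compose[OF X_restrict_measurable[OF env_in_subset] opt_env_measurable[OF subset_refl subset_refl]])

lemma block_max_nonneg: "0 \<le> block_max K a b \<omega>"
  unfolding block_max_def by (intro opt_nonneg) simp

lemma block_max_le: "0 \<le> K \<Longrightarrow> a \<le> b \<Longrightarrow> block_max K a b \<omega> \<le> K * real_of_int (b - a)"
  unfolding block_max_def by (intro best_le cut_le)

lemma block_max_integrable: "0 \<le> K \<Longrightarrow> a \<le> b \<Longrightarrow> integrable M (block_max K a b)"
  using block_max_nonneg block_max_le by (intro integrable_const_bound[where B = "K * real_of_int (b - a)"]) auto

lemma prob_space_distr_v: "e \<in> edges \<Longrightarrow> prob_space \<nu>"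
  using prob_space_distr[OF v_measurable] law by metis

lemma distr_X_shift:
  assumes "i \<in> edges <+> edges"
  shows "distr M borel (X (map_sum (shift_edge a) (shift_edge a) i)) = distr M borel (X i)"
proof (cases i)
  case (Inl e)
  with assms show ?thesis by (auto simp: law)
next
  case (Inr e)
  with assms have e: "e \<in> edges" by auto
  let ?P = "\<lambda>e. {\<omega> \<in> space M. present e \<omega>}"
  have vim: "X (Inr e') -` A \<inter> space M =
      (if 1 \<in> A then if 0 \<in> A then space M else ?P e' else if 0 \<in> A then space M - ?P e' else {})"
    for e' A by (auto simp: of_bool_def split: if_splits)
  have em: "prob (X (Inr e') -` A \<inter> space M) =
      (if 1 \<in> A then if 0 \<in> A then 1 else p else if 0 \<in> A then 1 - p else 0)" if "e' \<in> edges" for e' A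
    unfolding vim using prob_edge[OF that] prob_compl[OF present_event[OF that]] by (simp add: prob_space)
  have "distr M borel (X (Inr e')) = distr M borel (X (Inr e''))"
    if e': "e' \<in> edges" "e'' \<in> edges" for e' e''
  proof (rule measure_eqI)
    fix A :: "real set" assume "A \<in> sets (distr M borel (X (Inr e')))"
    then have A: "A \<in> sets borel" by simp
    have rv: "random_variable borel (X (Inr e'))" "random_variable borel (X (Inr e''))"
      by (rule X_measurable[OF InrI[OF e'(1)]], rule X_measurable[OF InrI[OF e'(2)]])
    show "emeasure (distr M borel (X (Inr e'))) A = emeasure (distr M borel (X (Inr e''))) A"
      unfolding emeasure_distr[OF rv(1) A] emeasure_distr[OF rv(2) A] emeasure_eq_measure
        em[OF e'(1)] em[OF e'(2)] by (rule refl)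
  qed (simp only: sets_distr)
  from this[of "shift_edge a e" e] e show ?thesis
    by (simp only: Inr map_sum.simps shift_edge_mem)
qed

definition mean_max :: "real \<Rightarrow> nat \<Rightarrow> real" where
  "mean_max K m = expectation (block_max K 0 (int m))"

text \<open>Translation by \<open>a\<close> is an injective relabelling of the coordinates that
  preserves every marginal law, and it maps the block starting at 0 to the block starting at
  \<open>a\<close>.\<close>

lemma expectation_block_max:
  assumes "a + int m = c"
  shows "expectation (block_max K a c) = mean_max K m"
proof -
  let ?s = "map_sum (shift_edge a) (shift_edge a)"
  let ?F = "opt_env (increasing_lists 0 (int m)) K"
  let ?J = "env_in 0 (int m)"
  have "block_max K a c \<omega> = ?F (\<lambda>i\<in>?J. X (?s i) \<omega>)" for \<omega>
    using best_shift[of 0 a "int m" "\<lambda>e. present e \<omega>" "\<lambda>e. cut K (v e \<omega>)"] assms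
    by (subst opt_env_restrict) (simp_all add: opt_env_def block_max_def add.commute)
  moreover have "expectation (\<lambda>\<omega>. ?F (\<lambda>i\<in>?J. X (?s i) \<omega>)) = expectation (\<lambda>\<omega>. ?F (\<lambda>i\<in>?J. X i \<omega>))"
  proof (rule indep_vars_expectation_reindex[OF indep_X env_in_subset])
    show "?s ` ?J \<subseteq> edges <+> edges"
      using edges_in_subset_edges[of 0 "int m"] by (auto simp: env_in_def subset_iff)
    show "inj_on ?s ?J"
      using inj_shift_edge[of a] by (intro inj_on_subset[OF sum.inj_map]) auto
    show "distr M borel (X (?s i)) = distr M borel (X i)" if "i \<in> ?J" for i
      using that env_in_subset by (intro distr_X_shift) auto
  qed (rule opt_env_measurable[OF subset_refl subset_refl])
  ultimately show ?thesis
    by (simp add: mean_max_def block_max_eq_opt_env[abs_def])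
qed

lemma mean_max_nonneg: "0 \<le> mean_max K m"
  unfolding mean_max_def by (intro Bochner_Integration.integral_nonneg block_max_nonneg)

lemma mean_max_subadd:
  assumes "0 \<le> K"
  shows "mean_max K (m + n) \<le> mean_max K m + mean_max K n + K"
proof -
  have "mean_max K (m + n) \<le> expectation (\<lambda>\<omega>. block_max K 0 (int m) \<omega> + block_max K (int m) (int (m + n)) \<omega> + K)"
    unfolding mean_max_def using assms
    by (intro integral_mono Bochner_Integration.integrable_add block_max_integrable)
       (auto simp: block_max_def intro!: best_split cut_le)
  also have "\<dots> = mean_max K m + mean_max K n + K"
    using assms expectation_block_max[of "int m" n "int (m + n)" K]
    by (simp add: block_max_integrable mean_max_def prob_space)
  finally show ?thesis .
qed

definition rate :: "real \<Rightarrow> real" where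
  "rate K = lim (\<lambda>m. mean_max K m / real m)"

lemma rate_LIMSEQ:
  assumes "0 \<le> K"
  shows "(\<lambda>m. mean_max K m / real m) \<longlonglongrightarrow> rate K"
proof -
  \<comment> \<open>Adding the constant \<open>K\<close> absorbs the error \<open>K\<close> of
    \<open>mean_max_subadd\<close> and makes the sequence subadditive; divided by \<open>m\<close>
    the constant disappears.\<close>
  have "convergent (\<lambda>m. (mean_max K m + K) / real m)"
    by (rule fekete) (use mean_max_subadd[OF assms] mean_max_nonneg assms in \<open>auto simp: algebra_simps\<close>)
  then obtain L where "(\<lambda>m. (mean_max K m + K) / real m) \<longlonglongrightarrow> L" by (auto simp: convergent_def)
  moreover have "(\<lambda>m. K / real m) \<longlonglongrightarrow> 0" by real_asymp
  ultimately have "(\<lambda>m. (mean_max K m + K) / real m - K / real m) \<longlonglongrightarrow> L - 0" by (rule tendsto_diff)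
  then have "(\<lambda>m. mean_max K m / real m) \<longlonglongrightarrow> L" by (simp add: add_divide_distrib)
  then show ?thesis by (simp add: rate_def limI)
qed

text \<open>Hoeffding's inequality for \<open>N\<close> independent variables with values in
  \<open>[0, K * m]\<close> at deviation \<open>\<eta> * N * m\<close>. The factors \<open>m\<close>
  cancel in the exponent, which is linear in \<open>N\<close>. The upper bound on the path weight
  uses \<open>g = 0\<close>, the lower bound leaves a space \<open>g\<close> for the links.\<close>

lemma block_max_blocks_concentration:
  assumes "0 < K" "0 < \<eta>" "g < m" "0 < N"
  shows "prob {\<omega> \<in> space M. \<eta> * real N * real m \<le>
      \<bar>(\<Sum>k<N. block_max K (int (k * m + g)) (int (k * m + m)) \<omega>) - real N * mean_max K (m - g)\<bar>}
    \<le> 2 * exp (- (2 * \<eta>\<^sup>2 / K\<^sup>2) * real N)"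
proof -
  let ?a = "\<lambda>k. int (k * m + g)" and ?b = "\<lambda>k. int (k * m + m)"
  have disj: "disjoint_family_on (\<lambda>k. env_in (?a k) (?b k)) {..<N}"
  proof -
    have less: "\<not> k < k'" if "i < int k * int m + int m" "int k' * int m \<le> i" for k k' i
    proof
      assume "k < k'"
      then have "int (Suc k) * int m \<le> int k' * int m" by (intro mult_right_mono) auto
      with that show False by (simp add: algebra_simps)
    qed
    have "edges_in (?a k) (?b k) \<inter> edges_in (?a k') (?b k') = {}" if "k \<noteq> k'" for k k'
    proof -
      have False if "(i, j) \<in> edges_in (?a k) (?b k)" "(i, j) \<in> edges_in (?a k') (?b k')" for i j
      proof -
        have "i < int k * int m + int m" "int k * int m \<le> i"
          "i < int k' * int m + int m" "int k' * int m \<le> i"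
          using that by (auto simp: edges_in_def)
        with less[of i k k'] less[of i k' k] \<open>k \<noteq> k'\<close> show False by linarith
      qed
      then show ?thesis by auto
    qed
    then have "env_in (?a k) (?b k) \<inter> env_in (?a k') (?b k') = {}" if "k \<noteq> k'" for k k'
      using that unfolding env_in_def by blast
    then show ?thesis by (auto simp only: disjoint_family_on_def)
  qed
  have indep: "indep_vars (\<lambda>_. borel) (\<lambda>k. block_max K (?a k) (?b k)) {..<N}"
    unfolding block_max_eq_opt_env[abs_def]
    by (rule indep_vars_on_blocks[OF indep_X _ disj, where F = "\<lambda>k. opt_env (increasing_lists (?a k) (?b k)) K"])
       (rule env_in_subset, rule opt_env_measurable[OF subset_refl subset_refl])
  interpret H: Hoeffding_ineq M "{..<N}" "\<lambda>k. block_max K (?a k) (?b k)" "\<lambda>_. 0" "\<lambda>_. K * real m" "real N * mean_max K (m - g)"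
  proof unfold_locales
    have "block_max K (?a k) (?b k) \<omega> \<le> K * real m" for k \<omega>
    proof -
      have "block_max K (?a k) (?b k) \<omega> \<le> K * real_of_int (?b k - ?a k)" using assms by (intro block_max_le) auto
      also have "\<dots> \<le> K * real m" using assms by (intro mult_left_mono) auto
      finally show ?thesis .
    qed
    then show "AE \<omega> in M. block_max K (?a k) (?b k) \<omega> \<in> {0..K * real m}" for k
      using block_max_nonneg by (intro AE_I2) auto
    have "expectation (block_max K (?a k) (?b k)) = mean_max K (m - g)" for k
      using assms(3) by (intro expectation_block_max) (simp add: of_nat_diff)
    then show "real N * mean_max K (m - g) \<equiv> \<Sum>k<N. expectation (block_max K (?a k) (?b k))"
      by (intro eq_reflection) simp
  qed (use indep in auto)
  have sum_eq: "(\<Sum>k<N. (K * real m - 0)\<^sup>2) = real N * (K\<^sup>2 * (real m)\<^sup>2)"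
    by (simp add: power_mult_distrib)
  have "0 < (\<Sum>k<N. (K * real m - 0)\<^sup>2)" using assms unfolding sum_eq by simp
  from H.Hoeffding_ineq_abs_ge[OF _ this, of "\<eta> * real N * real m"] assms(1-2)
  have "prob {\<omega> \<in> space M. \<eta> * real N * real m \<le>
      \<bar>(\<Sum>k<N. block_max K (?a k) (?b k) \<omega>) - real N * mean_max K (m - g)\<bar>}
    \<le> 2 * exp (- 2 * (\<eta> * real N * real m)\<^sup>2 / (real N * (K\<^sup>2 * (real m)\<^sup>2)))"
    unfolding sum_eq by simp
  also have "- 2 * (\<eta> * real N * real m)\<^sup>2 / (real N * (K\<^sup>2 * (real m)\<^sup>2)) = - (2 * \<eta>\<^sup>2 / K\<^sup>2) * real N"
    using assms by (simp add: power_mult_distrib power2_eq_square[of "real N"])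
  finally show ?thesis .
qed

end

section \<open>Block and gap lengths, and the summability of error terms\<close>

definition blk :: "nat \<Rightarrow> nat" where "blk n = nat \<lfloor>sqrt (real n)\<rfloor>"
text \<open>The exponent 1/4 lies below the 1/2 of \<open>blk\<close>, so the part of a block given
  up for a link is negligible; any positive power of \<open>n\<close> makes the failure probability
  of a link beat the number of pairs to be linked.\<close>

definition gap :: "nat \<Rightarrow> nat" where "gap n = nat \<lfloor>real n powr (1/4)\<rfloor>"

lemma blk_le: "blk n * blk n \<le> n"
  and less_Suc_blk: "n < Suc (blk n) * Suc (blk n)"
proof -
  have m: "real (blk n) \<le> sqrt (real n)" "sqrt (real n) < real (blk n) + 1"
    by (auto simp: blk_def)
  have "(real (blk n))\<^sup>2 \<le> (sqrt (real n))\<^sup>2" using m(1) by (intro power_mono) auto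
  then have "real (blk n * blk n) \<le> real n" by (simp add: power2_eq_square)
  then show "blk n * blk n \<le> n" by (simp only: of_nat_le_iff)
  have "(sqrt (real n))\<^sup>2 < (real (blk n) + 1)\<^sup>2" using m(2) by (intro power_strict_mono) auto
  then have "real n < real (Suc (blk n) * Suc (blk n))" by (simp add: power2_eq_square algebra_simps)
  then show "n < Suc (blk n) * Suc (blk n)" by (simp only: of_nat_less_iff)
qed

lemma blk_at_top: "filterlim blk at_top sequentially"
  unfolding blk_def by real_asymp

lemma blk_pos: "\<forall>\<^sub>F n in sequentially. 0 < blk n"
  using filterlim_at_top[THEN iffD1, rule_format, OF blk_at_top, of 1]
  by (rule eventually_mono) simp

lemma gap_less_blk: "\<forall>\<^sub>F n in sequentially. gap n < blk n"
proof -
  have "\<forall>\<^sub>F n in sequentially. real (gap n) < real (blk n)"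
    unfolding blk_def gap_def by real_asymp
  then show ?thesis by simp
qed

lemma blk_minus_gap_at_top: "filterlim (\<lambda>n. blk n - gap n) at_top sequentially"
  unfolding blk_def gap_def by real_asymp

lemma blk_upper_ratio: "(\<lambda>n. real (blk n + 3) * real (blk n) / real n) \<longlonglongrightarrow> 1"
  and blk_upper_count: "(\<lambda>n. real (blk n + 3) / real n) \<longlonglongrightarrow> 0"
  unfolding blk_def by real_asymp+

lemma blk_lower_ratio: "(\<lambda>n. real (blk n - 1) * real (blk n - gap n) / real n) \<longlonglongrightarrow> 1"
  and blk_lower_ratio': "(\<lambda>n. real (blk n - 1) * real (blk n) / real n) \<longlonglongrightarrow> 1"
  unfolding blk_def gap_def by real_asymp+

lemma summable_if_bigo_inverse_square:
  fixes f :: "nat \<Rightarrow> real"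
  assumes "f \<in> O(\<lambda>n. 1 / real n ^ 2)"
  shows "summable f"
proof (rule summable_comparison_test_bigo[OF _ assms])
  show "summable (\<lambda>n. norm (1 / real n ^ 2))"
    using inverse_power_summable[of 2, where 'a = real] by (simp add: inverse_eq_divide)
qed

lemma summable_exp_blk:
  fixes c :: real
  assumes "0 < c"
  shows "summable (\<lambda>n. exp (- c * real (blk n + 3)))" "summable (\<lambda>n. exp (- c * real (blk n - 1)))"
  unfolding blk_def by (rule summable_if_bigo_inverse_square, use assms in real_asymp)+

lemma summable_exp_gap:
  fixes c :: real
  assumes "0 < c"
  shows "summable (\<lambda>n. (real n + 1)\<^sup>2 * exp (- c * real (gap n - 1)))"
  unfolding gap_def by (rule summable_if_bigo_inverse_square, use assms in real_asymp)

section \<open>Almost sure bounds for sums of block maxima\<close>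

context weighted_random_digraph
begin

text \<open>Borel-Cantelli applied to the Hoeffding bound, for block numbers that grow fast enough.
  The exceptional null set is made independent of \<open>\<eta>\<close>.\<close>

lemma block_max_blocks_AE:
  fixes m g N :: "nat \<Rightarrow> nat"
  assumes "0 < K" and ev: "\<forall>\<^sub>F n in sequentially. g n < m n \<and> 0 < N n"
    and summ: "\<And>c. 0 < c \<Longrightarrow> summable (\<lambda>n. exp (- c * real (N n)))"
  shows "AE \<omega> in M. \<forall>\<eta>>0. \<forall>\<^sub>F n in sequentially.
    \<bar>(\<Sum>k<N n. block_max K (int (k * m n + g n)) (int (k * m n + m n)) \<omega>) - real (N n) * mean_max K (m n - g n)\<bar>
      \<le> \<eta> * real (N n) * real (m n)"
proof -
  let ?D = "\<lambda>n \<omega>. \<bar>(\<Sum>k<N n. block_max K (int (k * m n + g n)) (int (k * m n + m n)) \<omega>) - real (N n) * mean_max K (m n - g n)\<bar>"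
  have "AE \<omega> in M. \<forall>\<^sub>F n in sequentially. ?D n \<omega> \<le> \<eta> * real (N n) * real (m n)" if "0 < \<eta>" for \<eta>
  proof -
    \<comment> \<open>The concentration bound is available only under its side conditions, which
      hold eventually; elsewhere the bad event is replaced by the empty set so that the estimate
      covers all \<open>n\<close>.\<close>
    define A where "A n = (if g n < m n \<and> 0 < N n
      then {\<omega> \<in> space M. \<eta> * real (N n) * real (m n) \<le> ?D n \<omega>} else {})" for n
    define c where "c = 2 * \<eta>\<^sup>2 / K\<^sup>2"
    have "0 < c" using that assms(1) by (simp add: c_def)
    have "AE \<omega> in M. \<forall>\<^sub>F n in sequentially. \<omega> \<notin> A n"
    proof (rule borel_cantelli_prob)
      show "A n \<in> events" for n by (simp add: A_def)
      show "prob (A n) \<le> 2 * exp (- c * real (N n))" for n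
        using block_max_blocks_concentration[of K \<eta> "g n" "m n" "N n"] assms(1) that
        by (auto simp: A_def c_def)
      show "summable (\<lambda>n. 2 * exp (- c * real (N n)))"
        by (intro summable_mult summ \<open>0 < c\<close>)
    qed
    then show ?thesis
    proof (rule AE_mp, intro AE_I2 impI)
      fix \<omega> assume \<omega>: "\<omega> \<in> space M" and "\<forall>\<^sub>F n in sequentially. \<omega> \<notin> A n"
      from eventually_conj[OF this(2) ev]
      show "\<forall>\<^sub>F n in sequentially. ?D n \<omega> \<le> \<eta> * real (N n) * real (m n)"
        by (rule eventually_mono) (use \<omega> in \<open>auto simp: A_def\<close>)
    qed
  qed
  \<comment> \<open>The bound is monotone in \<open>\<eta>\<close>, so the countably many values
    \<open>1 / (j + 1)\<close> suffice.\<close>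
  then have "AE \<omega> in M. \<forall>j. \<forall>\<^sub>F n in sequentially. ?D n \<omega> \<le> inverse (real (Suc j)) * real (N n) * real (m n)"
    by (simp add: AE_all_countable)
  then show ?thesis
  proof (rule AE_mp, intro AE_I2 impI allI)
    fix \<omega> and \<eta> :: real
    assume ev: "\<forall>j. \<forall>\<^sub>F n in sequentially. ?D n \<omega> \<le> inverse (real (Suc j)) * real (N n) * real (m n)"
      and "0 < \<eta>"
    then obtain j where j: "inverse (real (Suc j)) < \<eta>" using reals_Archimedean by blast
    from ev have "\<forall>\<^sub>F n in sequentially. ?D n \<omega> \<le> inverse (real (Suc j)) * real (N n) * real (m n)" ..
    then show "\<forall>\<^sub>F n in sequentially. ?D n \<omega> \<le> \<eta> * real (N n) * real (m n)"
    proof (rule eventually_mono)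
      fix n assume le: "?D n \<omega> \<le> inverse (real (Suc j)) * real (N n) * real (m n)"
      have "inverse (real (Suc j)) * real (N n) * real (m n) \<le> \<eta> * real (N n) * real (m n)"
        using j by (intro mult_right_mono) auto
      with le show "?D n \<omega> \<le> \<eta> * real (N n) * real (m n)" by (rule order_trans)
    qed
  qed
qed

lemma block_max_upper:
  assumes "0 < K"
  shows "AE \<omega> in M. \<forall>\<eta>>0. \<forall>\<^sub>F n in sequentially. block_max K 0 (int n + 1) \<omega> \<le> (rate K + \<eta>) * real n"
proof -
  let ?m = blk and ?N = "\<lambda>n. blk n + 3"
  have "AE \<omega> in M. \<forall>\<eta>>0. \<forall>\<^sub>F n in sequentially.
      \<bar>(\<Sum>k<?N n. block_max K (int (k * ?m n + 0)) (int (k * ?m n + ?m n)) \<omega>) - real (?N n) * mean_max K (?m n - 0)\<bar>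
        \<le> \<eta> * real (?N n) * real (?m n)"
    using blk_pos by (intro block_max_blocks_AE assms summable_exp_blk) simp_all
  then show ?thesis
  proof (rule AE_mp, intro AE_I2 impI allI)
    fix \<omega> and \<eta> :: real
    assume "0 < \<eta>" and all: "\<forall>\<eta>>0. \<forall>\<^sub>F n in sequentially.
      \<bar>(\<Sum>k<?N n. block_max K (int (k * ?m n + 0)) (int (k * ?m n + ?m n)) \<omega>) - real (?N n) * mean_max K (?m n - 0)\<bar>
        \<le> \<eta> * real (?N n) * real (?m n)"
    define \<eta>' where "\<eta>' = \<eta> / 2"
    have "0 < \<eta>'" "\<eta>' < \<eta>" using \<open>0 < \<eta>\<close> by (auto simp: \<eta>'_def)
    \<comment> \<open>\<open>R n\<close> is the bound for the block sum divided by \<open>n\<close>: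
      mean part, deviation, and one crossing edge per block. It tends to
      \<open>rate K + \<eta> / 2\<close>.\<close>
    define R where "R n = real (?N n) * real (?m n) / real n * (mean_max K (?m n) / real (?m n))
      + \<eta>' * (real (?N n) * real (?m n) / real n) + real (?N n) / real n * K" for n
    have "(\<lambda>n. mean_max K (?m n) / real (?m n)) \<longlonglongrightarrow> rate K"
      by (rule filterlim_compose[OF rate_LIMSEQ blk_at_top]) (use assms in simp)
    then have "R \<longlonglongrightarrow> 1 * rate K + \<eta>' * 1 + 0 * K"
      unfolding R_def
      by (intro tendsto_add tendsto_mult tendsto_const blk_upper_ratio blk_upper_count)
    then have "\<forall>\<^sub>F n in sequentially. R n < rate K + \<eta>"
      by (rule order_tendstoD) (use \<open>\<eta>' < \<eta>\<close> in simp)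
    moreover note blk_pos all[rule_format, OF \<open>0 < \<eta>'\<close>] eventually_gt_at_top[of 0]
    ultimately show "\<forall>\<^sub>F n in sequentially. block_max K 0 (int n + 1) \<omega> \<le> (rate K + \<eta>) * real n"
    proof eventually_elim
      case (elim n)
      \<comment> \<open>This is why three extra blocks are used: with \<open>m = blk n > 0\<close>,
        \<open>n + 1 \<le> (m + 1) * (m + 1) = m * m + 2 * m + 1 \<le> (m + 3) * m\<close>.\<close>
      have "n + 1 \<le> ?N n * ?m n" using less_Suc_blk[of n] elim(2) by (simp add: algebra_simps)
      then have "int n + 1 \<le> int (?N n * ?m n)" by linarith
      then have "block_max K 0 (int n + 1) \<omega> \<le> block_max K 0 (int (?N n * ?m n)) \<omega>"
        unfolding block_max_def by (intro best_mono_interval) auto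
      also have "\<dots> \<le> (\<Sum>k<?N n. block_max K (int (k * ?m n)) (int (k * ?m n + ?m n)) \<omega>) + real (?N n) * K"
        unfolding block_max_def using assms by (intro best_blocks cut_le) auto
      also have "\<dots> \<le> real (?N n) * mean_max K (?m n) + \<eta>' * real (?N n) * real (?m n) + real (?N n) * K"
        using elim(3) by simp
      also have "\<dots> = R n * real n" using elim by (simp add: R_def field_simps)
      also have "\<dots> \<le> (rate K + \<eta>) * real n" using elim(1) by (intro mult_right_mono) auto
      finally show ?case .
    qed
  qed
qed

section \<open>Existence of two-edge links\<close>

lemma not_joins_event:
  assumes "i < j"
  shows "{\<omega> \<in> space M. \<not> joins (\<lambda>e. present e \<omega>) i j} \<in> events"
proof -
  have "{\<omega> \<in> space M. \<not> joins (\<lambda>e. present e \<omega>) i j} = space M -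
      (\<Union>z\<in>{i<..<j}. {\<omega> \<in> space M. present (i, z) \<omega>} \<inter> {\<omega> \<in> space M. present (z, j) \<omega>})"
    by (auto simp: joins_def)
  also have "\<dots> \<in> events"
    by (intro sets.Diff sets.finite_UN sets.Int present_event) (auto simp: edges_def)
  finally show ?thesis .
qed

text \<open>The pairs of edges through different middle vertices \<open>z\<close> are disjoint, so
  the \<open>j - i - 1\<close> possible links fail independently, each with probability
  \<open>1 - p^2\<close>. The indicator of failure is written as the product of the variables
  \<open>?Y z\<close>.\<close>

lemma prob_not_joins:
  assumes "i < j"
  shows "prob {\<omega> \<in> space M. \<not> joins (\<lambda>e. present e \<omega>) i j} = (1 - p\<^sup>2) ^ nat (j - i - 1)"
proof -
  let ?Z = "{i<..<j}"
  let ?K = "\<lambda>z. {Inr (i, z), Inr (z, j)} :: ((int \<times> int) + (int \<times> int)) set"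
  let ?F = "\<lambda>z y. 1 - y (Inr (i, z)) * y (Inr (z, j)) :: real"
  let ?P = "\<lambda>e. {\<omega> \<in> space M. present e \<omega>}"
  let ?Y = "\<lambda>z \<omega>. 1 - of_bool (present (i, z) \<omega>) * of_bool (present (z, j) \<omega>) :: real"
  have "indep_vars (\<lambda>_. borel) (\<lambda>z \<omega>. ?F z (\<lambda>i\<in>?K z. X i \<omega>)) ?Z"
  proof (rule indep_vars_on_blocks[OF indep_X])
    show "?K z \<subseteq> edges <+> edges" if "z \<in> ?Z" for z
      using that by (auto simp: edges_def)
    show "disjoint_family_on ?K ?Z" by (auto simp: disjoint_family_on_def)
    show "?F z \<in> borel_measurable (PiM (?K z) (\<lambda>_. borel))" for z
      by (intro borel_measurable_diff borel_measurable_times borel_measurable_const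
          measurable_component_singleton) auto
  qed
  then have ind: "indep_vars (\<lambda>_. borel) ?Y ?Z" by simp
  have E: "integrable M (?Y z)" "expectation (?Y z) = 1 - p\<^sup>2" if "z \<in> ?Z" for z
  proof -
    let ?A = "?P (i, z) \<inter> ?P (z, j)"
    have e: "(i, z) \<in> edges" "(z, j) \<in> edges" "(i, z) \<noteq> (z, j)" using that by (auto simp: edges_def)
    have "prob (\<Inter>e\<in>{(i, z), (z, j)}. ?P e) = (\<Prod>e\<in>{(i, z), (z, j)}. prob (?P e))"
      using indep_edges e unfolding indep_events_def_alt by (intro indep_setsD) auto
    then have "prob ?A = p\<^sup>2"
      using e prob_edge by (simp add: power2_eq_square)
    moreover have A: "?A \<in> events" using e by (intro sets.Int present_event)
    moreover have eq: "?Y z \<omega> = 1 - indicator ?A \<omega>" if "\<omega> \<in> space M" for \<omega>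
      using that by (auto simp: indicator_def)
    have "expectation (?Y z) = expectation (\<lambda>\<omega>. 1 - indicator ?A \<omega>)"
      by (rule Bochner_Integration.integral_cong) (auto simp only: eq)
    ultimately show "expectation (?Y z) = 1 - p\<^sup>2"
      by (subst \<open>expectation (?Y z) = _\<close>, subst Bochner_Integration.integral_diff)
         (auto simp: prob_space emeasure_eq_measure)
    have "integrable M (\<lambda>\<omega>. 1 - indicator ?A \<omega> :: real)"
      using A by (intro Bochner_Integration.integrable_diff) (auto simp: emeasure_eq_measure)
    then show "integrable M (?Y z)"
      by (subst Bochner_Integration.integrable_cong[OF refl eq])
  qed
  have "prob {\<omega> \<in> space M. \<not> joins (\<lambda>e. present e \<omega>) i j} =
      expectation (\<lambda>\<omega>. indicator {\<omega> \<in> space M. \<not> joins (\<lambda>e. present e \<omega>) i j} \<omega>)"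
    using not_joins_event[OF assms] by simp
  also have "\<dots> = expectation (\<lambda>\<omega>. \<Prod>z\<in>?Z. ?Y z \<omega>)"
  proof (rule Bochner_Integration.integral_cong[OF refl])
    fix \<omega> assume "\<omega> \<in> space M"
    show "indicator {\<omega> \<in> space M. \<not> joins (\<lambda>e. present e \<omega>) i j} \<omega> = (\<Prod>z\<in>?Z. ?Y z \<omega>)"
    proof (cases "joins (\<lambda>e. present e \<omega>) i j")
      case True
      then obtain z where z: "z \<in> ?Z" "present (i, z) \<omega>" "present (z, j) \<omega>"
        unfolding joins_def by blast
      then have "?Y z \<omega> = 0" by simp
      with z(1) have "(\<Prod>z\<in>?Z. ?Y z \<omega>) = 0"
        by (intro prod_zero finite_greaterThanLessThan_int) blast
      with True show ?thesis by simp
    next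
      case False
      have "?Y z \<omega> = 1" if "z \<in> ?Z" for z
      proof -
        have "\<not> (present (i, z) \<omega> \<and> present (z, j) \<omega>)" using False that by (auto simp: joins_def)
        then show ?thesis by auto
      qed
      then have "(\<Prod>z\<in>?Z. ?Y z \<omega>) = 1" by (intro prod.neutral) auto
      with False \<open>\<omega> \<in> space M\<close> show ?thesis by simp
    qed
  qed
  also have "\<dots> = (\<Prod>z\<in>?Z. expectation (?Y z))"
    by (rule indep_vars_lebesgue_integral[OF _ ind]) (auto simp only: E finite_greaterThanLessThan_int)
  also have "\<dots> = (1 - p\<^sup>2) ^ nat (j - i - 1)" by (simp only: E prod_constant cong: prod.cong) (simp add: algebra_simps)
  finally show ?thesis .
qed


text \<open>A union bound over at most \<open>(n + 1)^2\<close> pairs. The estimate of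
  \<open>1 - p^2\<close> by the exponential of \<open>- p^2\<close> brings the failure probability
  into the form of \<open>summable_exp_gap\<close>.\<close>

lemma joins_AE:
  "AE \<omega> in M. \<forall>\<^sub>F n in sequentially. \<forall>i j. 0 \<le> i \<longrightarrow> i + int (gap n) \<le> j \<longrightarrow> j \<le> int n \<longrightarrow>
     joins (\<lambda>e. present e \<omega>) i j"
proof -
  let ?q = "1 - p\<^sup>2"
  have q: "0 \<le> ?q" "?q \<le> exp (- p\<^sup>2)"
    using p exp_ge_add_one_self[of "- p\<^sup>2"] power_le_one[of p 2] by auto
  \<comment> \<open>The condition \<open>i < j\<close> matters only when \<open>gap n = 0\<close>;
    eventually it follows from the distance condition.\<close>
  define S where "S n = {(i, j). 0 \<le> i \<and> i + int (gap n) \<le> j \<and> j \<le> int n \<and> i < j}" for n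
  define A where "A n = (\<Union>(i, j)\<in>S n. {\<omega> \<in> space M. \<not> joins (\<lambda>e. present e \<omega>) i j})" for n
  have S_sub: "S n \<subseteq> {0..int n} \<times> {0..int n}" for n by (auto simp: S_def)
  then have fin: "finite (S n)" for n by (rule finite_subset) simp
  have "card (S n) \<le> card ({0..int n} \<times> {0..int n})" for n
    using S_sub by (intro card_mono) auto
  then have card_nat: "card (S n) \<le> (n + 1) * (n + 1)" for n
    by (simp add: nat_add_distrib add.commute)
  have card: "real (card (S n)) \<le> (real n + 1)\<^sup>2" for n
  proof -
    have "real (card (S n)) \<le> real ((n + 1) * (n + 1))" using card_nat[of n] by (simp only: of_nat_le_iff)
    then show ?thesis by (simp add: power2_eq_square algebra_simps)
  qed
  have "AE \<omega> in M. \<forall>\<^sub>F n in sequentially. \<omega> \<notin> A n"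
  proof (rule borel_cantelli_prob)
    show "A n \<in> events" for n
      unfolding A_def by (intro sets.finite_UN fin) (auto simp: S_def intro!: not_joins_event)
    show "prob (A n) \<le> (real n + 1)\<^sup>2 * exp (- p\<^sup>2 * real (gap n - 1))" for n
    proof -
      have "prob (A n) \<le> (\<Sum>x\<in>S n. prob (case x of (i, j) \<Rightarrow> {\<omega> \<in> space M. \<not> joins (\<lambda>e. present e \<omega>) i j}))"
        unfolding A_def
        by (intro finite_measure_subadditive_finite fin) (auto simp: S_def intro!: not_joins_event)
      also have "\<dots> \<le> real (card (S n)) * ?q ^ (gap n - 1)"
      proof (rule sum_bounded_above)
        fix x assume "x \<in> S n"
        then show "prob (case x of (i, j) \<Rightarrow> {\<omega> \<in> space M. \<not> joins (\<lambda>e. present e \<omega>) i j}) \<le> ?q ^ (gap n - 1)"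
          using q(1) by (auto simp: S_def prob_not_joins intro!: power_decreasing)
      qed
      also have "\<dots> \<le> (real n + 1)\<^sup>2 * exp (- p\<^sup>2) ^ (gap n - 1)"
        using q by (intro mult_mono card power_mono) auto
      also have "\<dots> = (real n + 1)\<^sup>2 * exp (- p\<^sup>2 * real (gap n - 1))"
        by (simp only: exp_of_nat2_mult)
      finally show ?thesis .
    qed
    show "summable (\<lambda>n. (real n + 1)\<^sup>2 * exp (- p\<^sup>2 * real (gap n - 1)))"
      using p by (intro summable_exp_gap) simp
  qed
  then show ?thesis
  proof (rule AE_mp, intro AE_I2 impI)
    fix \<omega> assume \<omega>: "\<omega> \<in> space M" and "\<forall>\<^sub>F n in sequentially. \<omega> \<notin> A n"
    moreover have "\<forall>\<^sub>F n in sequentially. 0 < real (gap n)" unfolding gap_def by real_asymp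
    ultimately have "\<forall>\<^sub>F n in sequentially. \<omega> \<notin> A n \<and> 0 < gap n" by (auto intro: eventually_conj)
    then show "\<forall>\<^sub>F n in sequentially. \<forall>i j. 0 \<le> i \<longrightarrow> i + int (gap n) \<le> j \<longrightarrow> j \<le> int n \<longrightarrow>
        joins (\<lambda>e. present e \<omega>) i j"
      by (rule eventually_mono) (use \<omega> in \<open>force simp: A_def S_def\<close>)
  qed
qed

lemma path_lower:
  assumes "0 < K"
  shows "AE \<omega> in M. \<forall>\<eta>>0. \<forall>\<^sub>F n in sequentially. \<exists>xs. is_path (\<lambda>e. present e \<omega>) 0 (int n) xs \<and>
    (rate K - \<eta>) * real n \<le> path_weight (\<lambda>e. cut K (v e \<omega>)) xs"
proof -
  let ?m = blk and ?N = "\<lambda>n. blk n - 1" and ?g = gap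
  have ev: "\<forall>\<^sub>F n in sequentially. ?g n < ?m n \<and> 0 < ?N n"
    using filterlim_at_top[THEN iffD1, rule_format, OF blk_at_top, of 2] gap_less_blk
    by eventually_elim simp
  have "AE \<omega> in M. \<forall>\<eta>>0. \<forall>\<^sub>F n in sequentially.
      \<bar>(\<Sum>k<?N n. block_max K (int (k * ?m n + ?g n)) (int (k * ?m n + ?m n)) \<omega>) - real (?N n) * mean_max K (?m n - ?g n)\<bar>
        \<le> \<eta> * real (?N n) * real (?m n)"
    by (intro block_max_blocks_AE assms summable_exp_blk ev)
  with joins_AE show ?thesis
  proof (eventually_elim, intro impI allI)
    fix \<omega> and \<eta> :: real
    assume "0 < \<eta>" and all: "\<forall>\<eta>>0. \<forall>\<^sub>F n in sequentially.
      \<bar>(\<Sum>k<?N n. block_max K (int (k * ?m n + ?g n)) (int (k * ?m n + ?m n)) \<omega>) - real (?N n) * mean_max K (?m n - ?g n)\<bar>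
        \<le> \<eta> * real (?N n) * real (?m n)"
      and joins: "\<forall>\<^sub>F n in sequentially. \<forall>i j. 0 \<le> i \<longrightarrow> i + int (gap n) \<le> j \<longrightarrow> j \<le> int n \<longrightarrow>
        joins (\<lambda>e. present e \<omega>) i j"
    define \<eta>' where "\<eta>' = \<eta> / 2"
    have "0 < \<eta>'" "\<eta>' < \<eta>" using \<open>0 < \<eta>\<close> by (auto simp: \<eta>'_def)
    define R where "R n = real (?N n) * real (?m n - ?g n) / real n * (mean_max K (?m n - ?g n) / real (?m n - ?g n))
      - \<eta>' * (real (?N n) * real (?m n) / real n)" for n
    have "(\<lambda>n. mean_max K (?m n - ?g n) / real (?m n - ?g n)) \<longlonglongrightarrow> rate K"
      by (rule filterlim_compose[OF rate_LIMSEQ blk_minus_gap_at_top]) (use assms in simp)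
    then have "R \<longlonglongrightarrow> 1 * rate K - \<eta>' * 1"
      unfolding R_def
      by (intro tendsto_diff tendsto_mult tendsto_const blk_lower_ratio blk_lower_ratio')
    then have "\<forall>\<^sub>F n in sequentially. rate K - \<eta> < R n"
      by (rule order_tendstoD) (use \<open>\<eta>' < \<eta>\<close> in simp)
    from this ev joins all[rule_format, OF \<open>0 < \<eta>'\<close>] eventually_gt_at_top[of 0]
    show "\<forall>\<^sub>F n in sequentially. \<exists>xs. is_path (\<lambda>e. present e \<omega>) 0 (int n) xs \<and>
      (rate K - \<eta>) * real n \<le> path_weight (\<lambda>e. cut K (v e \<omega>)) xs"
    proof eventually_elim
      case (elim n)
      \<comment> \<open>One block fewer than \<open>blk n\<close> leaves a whole block length free,
        more than the last link to \<open>n\<close> requires.\<close>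
      have "?N n * ?m n + ?g n \<le> ?N n * ?m n + ?m n" using elim(2) by simp
      also have "\<dots> = ?m n * ?m n" using elim(2) by (simp add: algebra_simps)
      also have "\<dots> \<le> n" by (rule blk_le)
      finally have fit: "?N n * ?m n + ?g n \<le> n" .
      obtain xs where xs: "is_path (\<lambda>e. present e \<omega>) 0 (int n) xs"
        "(\<Sum>k<?N n. block_max K (int (k * ?m n + ?g n)) (int (k * ?m n + ?m n)) \<omega>) \<le> path_weight (\<lambda>e. cut K (v e \<omega>)) xs"
        using best_blocks_le_path_to[where u = "\<lambda>e. cut K (v e \<omega>)" and E = "\<lambda>e. present e \<omega>" and g = "?g n"
            and m = "?m n" and N = "?N n" and n = n] fit elim(2,3)
        unfolding block_max_def by auto
      have "(rate K - \<eta>) * real n \<le> R n * real n" using elim(1) by (intro mult_right_mono) auto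
      also have "\<dots> = real (?N n) * mean_max K (?m n - ?g n) - \<eta>' * real (?N n) * real (?m n)"
      proof -
        have "real (?m n - ?g n) \<noteq> 0" "real n \<noteq> 0" using elim(2,5) by auto
        then show ?thesis by (simp add: R_def field_simps)
      qed
      also have "\<dots> \<le> (\<Sum>k<?N n. block_max K (int (k * ?m n + ?g n)) (int (k * ?m n + ?m n)) \<omega>)"
        using elim(4) by linarith
      also have "\<dots> \<le> path_weight (\<lambda>e. cut K (v e \<omega>)) xs" by (rule xs(2))
      finally show ?case using xs(1) by blast
    qed
  qed
qed

end

section \<open>Positivity of the rate\<close>

context weighted_random_digraph
begin

lemma expectation_v:
  fixes f :: "real \<Rightarrow> real"
  assumes "e \<in> edges" "f \<in> borel_measurable borel"
  shows "expectation (\<lambda>\<omega>. f (v e \<omega>)) = (\<integral>x. f x \<partial>\<nu>)"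
  using integral_distr[OF v_measurable[OF assms(1)] assms(2)] law[OF assms(1)] by simp

lemma integrable_v_iff:
  fixes f :: "real \<Rightarrow> real"
  assumes "e \<in> edges" "f \<in> borel_measurable borel"
  shows "integrable M (\<lambda>\<omega>. f (v e \<omega>)) \<longleftrightarrow> integrable \<nu> f"
  using integrable_distr_eq[OF v_measurable[OF assms(1)] assms(2)] law[OF assms(1)] by simp

lemma prob_space_law: "prob_space \<nu>"
  by (rule prob_space_distr_v[of "(0, 1)"]) (simp add: edges_def)

lemma sets_law [simp, measurable_cong]: "sets \<nu> = sets borel"
  using law[of "(0, 1)"] by (auto simp: edges_def)

lemma integrable_cut: "0 \<le> K \<Longrightarrow> integrable \<nu> (cut K)"
proof -
  assume "0 \<le> K"
  interpret law: prob_space \<nu> by (rule prob_space_law)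
  show ?thesis
    by (rule law.integrable_const_bound[where B = K]) (simp_all add: cut_le \<open>0 \<le> K\<close>)
qed

lemma integral_cut_pos:
  assumes "0 < K"
  shows "0 < (\<integral>x. cut K x \<partial>\<nu>)"
proof -
  interpret law: prob_space \<nu> by (rule prob_space_law)
  have "\<not> (AE x in \<nu>. cut K x = 0)"
  proof
    assume "AE x in \<nu>. cut K x = 0"
    with law_pos have "AE x in \<nu>. False"
      by eventually_elim (use assms in \<open>auto simp: cut_def max_def min_def split: if_splits\<close>)
    then show False by simp
  qed
  then have "(\<integral>x. cut K x \<partial>\<nu>) \<noteq> 0"
    using integral_nonneg_eq_0_iff_AE[OF integrable_cut] assms by simp
  moreover have "0 \<le> (\<integral>x. cut K x \<partial>\<nu>)"
    by (rule Bochner_Integration.integral_nonneg) simp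
  ultimately show ?thesis by linarith
qed

section \<open>The gain from one additional vertex\<close>

definition lists_to :: "nat \<Rightarrow> int \<Rightarrow> int list set" where
  "lists_to n i = {xs \<in> increasing_lists 0 (int n). xs \<noteq> [] \<and> last xs = i}"

text \<open>Ties are broken by taking the smallest endpoint that achieves the optimum, so the events
  for different \<open>i\<close> partition the sample space. They read only edges inside
  \<open>[0, n)\<close>, because all lists involved stay there.\<close>

definition first_end :: "real \<Rightarrow> nat \<Rightarrow> env \<Rightarrow> int \<Rightarrow> bool" where
  "first_end K n y i \<longleftrightarrow>
     opt_env (lists_to n i) K y = opt_env (increasing_lists 0 (int n)) K y \<and>
     (\<forall>j\<in>{0..<i}. opt_env (lists_to n j) K y \<noteq> opt_env (increasing_lists 0 (int n)) K y)"

lemma lists_to_subset: "lists_to n i \<subseteq> increasing_lists 0 (int n)"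
  by (auto simp: lists_to_def)

lemma first_end_ex1:
  assumes "0 < n"
  shows "\<exists>!i. i \<in> {0..<int n} \<and> first_end K n y i"
proof -
  let ?E = "\<lambda>e. y (Inr e) = 1" and ?u = "\<lambda>e. cut K (y (Inl e))"
  let ?opt = "opt_env (increasing_lists 0 (int n)) K y"
  let ?Q = "\<lambda>k::nat. opt_env (lists_to n (int k)) K y = ?opt"
  have fin: "finite (lists_to n i)" for i
    using lists_to_subset finite_increasing_lists by (rule finite_subset)
  have le: "opt_env (lists_to n i) K y \<le> ?opt" for i
    unfolding opt_env_def using lists_to_subset[of n i]
    by (intro opt_leI fin opt_nonneg finite_increasing_lists path_weight_le_opt) auto
  have "\<exists>k<n. ?Q k"
  proof (cases rule: opt_attained[OF finite_increasing_lists[of 0 "int n"], of ?E ?u])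
    \<comment> \<open>If the optimum is 0, endpoint 0 achieves it: its restricted optimum lies
      between 0 and the full one.\<close>
    case 1
    then have "?Q 0"
      using le[of 0] opt_nonneg[OF fin, of 0 ?E ?u] by (simp add: opt_env_def)
    with assms show ?thesis by blast
  next
    case (2 xs)
    show ?thesis
    proof (cases "xs = []")
      case True
      with 2 have "?Q 0"
        using le[of 0] opt_nonneg[OF fin, of 0 ?E ?u] by (simp add: opt_env_def)
      with assms show ?thesis by blast
    next
      case False
      then have l: "last xs \<in> {0..<int n}"
        using 2(1) last_in_set[of xs] by (auto simp: increasing_lists_def subset_iff)
      have "xs \<in> lists_to n (last xs)" using 2(1) False by (simp add: lists_to_def)
      then have "?opt \<le> opt_env (lists_to n (last xs)) K y"
        using 2 path_weight_le_opt[OF fin, of xs "last xs" ?E ?u] by (simp add: opt_env_def)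
      with le[of "last xs"] l have "?Q (nat (last xs))" "nat (last xs) < n" by auto
      then show ?thesis by blast
    qed
  qed
  then obtain k where k: "k < n" "?Q k" by blast
  define l where "l = (LEAST k. ?Q k)"
  have l: "?Q l" "l \<le> k"
    unfolding l_def by (rule LeastI[of ?Q, OF k(2)], rule Least_le[of ?Q, OF k(2)])
  have less: "\<not> ?Q j" if "j < l" for j
    using that unfolding l_def by (rule not_less_Least)
  have first: "first_end K n y (int l)"
  proof -
    have "\<not> ?Q (nat j)" if "j \<in> {0..<int l}" for j using that by (intro less) auto
    then show ?thesis using l(1) by (simp add: first_end_def)
  qed
  show ?thesis
  proof (rule ex1I[of _ "int l"])
    show "int l \<in> {0..<int n} \<and> first_end K n y (int l)"
      using first l(2) k(1) by simp
    fix i assume i: "i \<in> {0..<int n} \<and> first_end K n y i"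
    have "\<not> i < int l" "\<not> int l < i"
      using i first by (auto simp: first_end_def)
    then show "i = int l" by simp
  qed
qed

lemma best_extend:
  assumes "0 < n" "\<And>e. 0 \<le> u e" "i \<in> {0..<int n}"
    "opt (lists_to n i) E u = best E u 0 (int n)" "E (i, int n)"
  shows "best E u 0 (int n) + u (i, int n) \<le> best E u 0 (int (Suc n))"
proof -
  have fin: "finite (lists_to n i)"
    using lists_to_subset finite_increasing_lists by (rule finite_subset)
  show ?thesis
  proof (cases rule: opt_attained[OF fin, of E u])
    \<comment> \<open>The value 0 need not be attained by a list ending in \<open>i\<close>, so the
      single edge from \<open>i\<close> to \<open>n\<close> takes the place of the extended
      path.\<close>
    case 1
    have "path_weight u [i, int n] \<le> best E u 0 (int (Suc n))"
      using assms by (intro path_weight_le_opt finite_increasing_lists) (auto simp: increasing_lists_def chain_Cons)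
    with 1 assms(4) show ?thesis by simp
  next
    case (2 xs)
    then have "path_weight u (xs @ [int n]) \<le> best E u 0 (int (Suc n))"
      using assms by (intro path_weight_le_opt finite_increasing_lists)
        (auto simp: lists_to_def increasing_lists_def sorted_wrt_append chain_append_iff subset_iff)
    then show ?thesis
      using 2 assms(4) by (simp add: lists_to_def path_weight_append)
  qed
qed

text \<open>The first endpoint \<open>i\<close> of an optimal path in \<open>[0, n)\<close> is independent of the edge \<open>(i, n)\<close>, so extending
  the optimal path by this edge, when present, gains a fixed amount in expectation.\<close>

lemma mean_max_Suc_ge:
  assumes "0 \<le> K" "0 < n"
  shows "mean_max K n + p * (\<integral>x. cut K x \<partial>\<nu>) \<le> mean_max K (Suc n)"
proof -
  let ?c = "\<integral>x. cut K x \<partial>\<nu>"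
  define T where "T i y = (if first_end K n y i then 1 else 0 :: real)" for i y
  have T_meas: "T i \<in> borel_measurable (PiM (env_in 0 (int n)) (\<lambda>_. borel))" for i
  proof -
    let ?N = "PiM (env_in 0 (int n)) (\<lambda>_. borel :: real measure)"
    have m: "opt_env (lists_to n j) K \<in> borel_measurable ?N"
      "opt_env (increasing_lists 0 (int n)) K \<in> borel_measurable ?N" for j
      by (rule opt_env_measurable[OF lists_to_subset subset_refl],
          rule opt_env_measurable[OF subset_refl subset_refl])
    have eq: "Measurable.pred ?N (\<lambda>y. opt_env (lists_to n j) K y = opt_env (increasing_lists 0 (int n)) K y)" for j
      unfolding Measurable.pred_def by (intro borel_measurable_eq m)
    have "Measurable.pred ?N (\<lambda>y. first_end K n y i)"
      unfolding first_end_def by (intro pred_intros_logic pred_intros_finite eq) simp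
    then show ?thesis unfolding T_def by measurable
  qed
  have T_restrict: "T i (\<lambda>j\<in>env_in 0 (int n). y j) = T i y" for i y
    by (simp add: T_def first_end_def opt_env_restrict lists_to_subset)
  let ?Y = "\<lambda>\<omega> i. X i \<omega>"
  let ?g = "\<lambda>i \<omega>. T i (?Y \<omega>) * (cut K (v (i, int n) \<omega>) * of_bool (present (i, int n) \<omega>))"
  have edge: "(i, int n) \<in> edges" if "i \<in> {0..<int n}" for i using that by (simp add: edges_def)
  have E: "integrable M (\<lambda>\<omega>. T i (?Y \<omega>)) \<and> integrable M (?g i) \<and>
      expectation (?g i) = expectation (\<lambda>\<omega>. T i (?Y \<omega>)) * (?c * p)"
    if i: "i \<in> {0..<int n}" for i
  proof -
    \<comment> \<open>Three disjoint sets of coordinates: everything inside \<open>[0, n)\<close>,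
      the weight of \<open>(i, n)\<close> and its presence. The edge ends at \<open>n\<close>,
      outside the half-open block.\<close>
    let ?K = "\<lambda>k::nat. if k = 0 then env_in 0 (int n) else if k = 1 then {Inl (i, int n)} else {Inr (i, int n)}"
    let ?F = "\<lambda>k::nat. \<lambda>y. if k = 0 then T i y else if k = 1 then cut K (y (Inl (i, int n))) else y (Inr (i, int n))"
    let ?Z = "\<lambda>k \<omega>. ?F k (\<lambda>j\<in>?K k. X j \<omega>)"
    have ind: "indep_vars (\<lambda>_. borel) ?Z {0, 1, 2}"
    proof (rule indep_vars_on_blocks[OF indep_X])
      show "?K k \<subseteq> edges <+> edges" if "k \<in> {0, 1, 2}" for k
        using that edge[OF i] env_in_subset by auto
      show "disjoint_family_on ?K {0, 1, 2}"
        by (auto simp: disjoint_family_on_def edges_in_def)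
      have "(\<lambda>y. y (Inl (i, int n))) \<in> borel_measurable (PiM {Inl (i, int n)} (\<lambda>_. borel :: real measure))"
        "(\<lambda>y. y (Inr (i, int n))) \<in> borel_measurable (PiM {Inr (i, int n)} (\<lambda>_. borel :: real measure))"
        by (intro measurable_component_singleton; simp)+
      then show "?F k \<in> borel_measurable (PiM (?K k) (\<lambda>_. borel))" if "k \<in> {0, 1, 2}" for k
        using that T_meas by auto
    qed
    have Z: "?Z 0 = (\<lambda>\<omega>. T i (?Y \<omega>))" "?Z 1 = (\<lambda>\<omega>. cut K (v (i, int n) \<omega>))"
      "?Z 2 = (\<lambda>\<omega>. of_bool (present (i, int n) \<omega>))"
      by (auto simp: fun_eq_iff T_restrict)
    have rv: "random_variable borel (?Z k)" if "k \<in> {0, 1, 2}" for k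
      using ind that by (simp only: indep_vars_def)
    have bounded: "\<bar>?Z k \<omega>\<bar> \<le> max 1 K" if "k \<in> {0, 1, 2}" for k \<omega>
      using that cut_le[OF assms(1), of "v (i, int n) \<omega>"] by (auto simp: T_restrict T_def)
    have int: "integrable M (?Z k)" if "k \<in> {0, 1, 2}" for k
      by (rule integrable_const_bound[where B = "max 1 K"]) (use rv[OF that] bounded[OF that] in auto)
    have "expectation (\<lambda>\<omega>. \<Prod>k\<in>{0, 1, 2}. ?Z k \<omega>) = (\<Prod>k\<in>{0, 1, 2}. expectation (?Z k))"
      by (rule indep_vars_lebesgue_integral[OF _ ind int]) simp_all
    moreover have "integrable M (\<lambda>\<omega>. \<Prod>k\<in>{0, 1, 2}. ?Z k \<omega>)"
      by (rule indep_vars_integrable[OF _ ind int]) simp_all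
    moreover have "(\<Prod>k\<in>{0, 1, 2}. f k) = f 0 * (f 1 * f 2)" for f :: "nat \<Rightarrow> real" by simp
    moreover have "expectation (?Z 1) = ?c"
      unfolding Z by (rule expectation_v[OF edge[OF i]]) simp
    moreover have "expectation (?Z 2) = p"
    proof -
      have "expectation (?Z 2) = expectation (indicator {\<omega> \<in> space M. present (i, int n) \<omega>})"
        unfolding Z by (rule Bochner_Integration.integral_cong) (auto simp: indicator_def)
      then show ?thesis using present_event[OF edge[OF i]] prob_edge[OF edge[OF i]] by simp
    qed
    ultimately show ?thesis using int[of 0] unfolding Z by (simp only: Z) (simp add: T_restrict)
  qed
  \<comment> \<open>Exactly one \<open>i\<close> is the first endpoint, so a sum against
    \<open>T\<close> evaluates at this random vertex. The random edge is thereby reduced to a sum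
    over deterministic edges, to each of which independence applies.\<close>
  have sum_T: "(\<Sum>i\<in>{0..<int n}. T i y * h i) = h i0"
    if "i0 \<in> {0..<int n}" "first_end K n y i0" for i0 y and h :: "int \<Rightarrow> real"
  proof -
    have "first_end K n y i \<longleftrightarrow> i = i0" if "i \<in> {0..<int n}" for i
      using first_end_ex1[OF assms(2), of K y] that \<open>i0 \<in> _\<close> \<open>first_end K n y i0\<close> by blast
    then have "(\<Sum>i\<in>{0..<int n}. T i y * h i) = (\<Sum>i\<in>{0..<int n}. if i = i0 then h i else 0)"
      by (intro sum.cong) (auto simp: T_def)
    with \<open>i0 \<in> _\<close> show ?thesis by simp
  qed
  have "block_max K 0 (int n) \<omega> + (\<Sum>i\<in>{0..<int n}. ?g i \<omega>) \<le> block_max K 0 (int (Suc n)) \<omega>" for \<omega>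
  proof -
    obtain i0 where i0: "i0 \<in> {0..<int n}" "first_end K n (?Y \<omega>) i0"
      using first_end_ex1[OF assms(2)] by blast
    then have "opt (lists_to n i0) (\<lambda>e. present e \<omega>) (\<lambda>e. cut K (v e \<omega>)) = block_max K 0 (int n) \<omega>"
      by (simp add: first_end_def opt_env_def block_max_def)
    from best_extend[OF assms(2) _ i0(1) this[unfolded block_max_def]]
    have "block_max K 0 (int n) \<omega> + cut K (v (i0, int n) \<omega>) \<le> block_max K 0 (int (Suc n)) \<omega>"
      if "present (i0, int n) \<omega>" using that by (simp add: block_max_def)
    moreover have "block_max K 0 (int n) \<omega> \<le> block_max K 0 (int (Suc n)) \<omega>"
      unfolding block_max_def by (intro best_mono_interval) auto
    ultimately show ?thesis
      unfolding sum_T[OF i0] by auto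
  qed
  then have "expectation (\<lambda>\<omega>. block_max K 0 (int n) \<omega> + (\<Sum>i\<in>{0..<int n}. ?g i \<omega>)) \<le> mean_max K (Suc n)"
    unfolding mean_max_def using assms E
    by (intro integral_mono Bochner_Integration.integrable_add Bochner_Integration.integrable_sum block_max_integrable) auto
  also have "expectation (\<lambda>\<omega>. block_max K 0 (int n) \<omega> + (\<Sum>i\<in>{0..<int n}. ?g i \<omega>)) =
      mean_max K n + (\<Sum>i\<in>{0..<int n}. expectation (?g i))"
    using assms E unfolding mean_max_def
    by (subst Bochner_Integration.integral_add)
       (auto intro!: block_max_integrable Bochner_Integration.integrable_sum Bochner_Integration.integral_sum)
  also have "(\<Sum>i\<in>{0..<int n}. expectation (?g i)) =
      (\<Sum>i\<in>{0..<int n}. expectation (\<lambda>\<omega>. T i (?Y \<omega>))) * (?c * p)"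
    using E by (simp add: sum_distrib_right)
  also have "(\<Sum>i\<in>{0..<int n}. expectation (\<lambda>\<omega>. T i (?Y \<omega>))) =
      expectation (\<lambda>\<omega>. \<Sum>i\<in>{0..<int n}. T i (?Y \<omega>) * 1)"
    using E by (subst Bochner_Integration.integral_sum) auto
  also have "(\<lambda>\<omega>. \<Sum>i\<in>{0..<int n}. T i (?Y \<omega>) * 1) = (\<lambda>\<omega>. 1)"
    using sum_T[of _ _ "\<lambda>_. 1"] first_end_ex1[OF assms(2)] by (intro ext) metis
  finally show ?thesis by (simp add: prob_space mult.commute)
qed

lemma rate_pos:
  assumes "0 < K"
  shows "0 < rate K"
proof -
  define c where "c = p * (\<integral>x. cut K x \<partial>\<nu>)"
  have "0 < c" using p integral_cut_pos[OF assms] by (simp add: c_def)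
  \<comment> \<open>The induction starts with one vertex, since the increment bound requires a
    nonempty block to extend from.\<close>
  have "real n * c \<le> mean_max K (Suc n)" for n
  proof (induction n)
    case (Suc n)
    then show ?case using mean_max_Suc_ge[of K "Suc n"] assms by (simp add: c_def algebra_simps)
  qed (simp add: mean_max_nonneg)
  then have "real n * c / real (Suc n) \<le> mean_max K (Suc n) / real (Suc n)" for n
    by (rule divide_right_mono) simp
  moreover have "(\<lambda>n. mean_max K (Suc n) / real (Suc n)) \<longlonglongrightarrow> rate K"
    using rate_LIMSEQ[of K] assms LIMSEQ_Suc[of "\<lambda>m. mean_max K m / real m"] by simp
  moreover have "(\<lambda>n. real n * c / real (Suc n)) \<longlonglongrightarrow> c" by real_asymp
  ultimately have "c \<le> rate K" by (intro LIMSEQ_le) auto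
  with \<open>0 < c\<close> show ?thesis by simp
qed

end

section \<open>The contribution of large weights\<close>

text \<open>The cross term between a new summand and the old sum vanishes by independence and
  centering.\<close>

lemma (in prob_space) second_moment_centered_sum:
  fixes Z :: "'i \<Rightarrow> 'a \<Rightarrow> real"
  assumes "finite I" "indep_vars (\<lambda>_. borel) Z I"
    and "\<And>i. i \<in> I \<Longrightarrow> integrable M (\<lambda>\<omega>. (Z i \<omega>)\<^sup>2)" "\<And>i. i \<in> I \<Longrightarrow> expectation (Z i) = 0"
  shows "integrable M (\<lambda>\<omega>. (\<Sum>i\<in>I. Z i \<omega>)\<^sup>2) \<and>
    expectation (\<lambda>\<omega>. (\<Sum>i\<in>I. Z i \<omega>)\<^sup>2) = (\<Sum>i\<in>I. expectation (\<lambda>\<omega>. (Z i \<omega>)\<^sup>2))"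
  using assms
proof (induction I rule: finite_induct)
  case (insert j I)
  have rv: "random_variable borel (Z i)" if "i \<in> insert j I" for i
    using insert.prems(1) that by (auto simp: indep_vars_def)
  have int: "integrable M (Z i)" if "i \<in> insert j I" for i
    using rv[OF that] insert.prems(2)[OF that] by (rule square_integrable_imp_integrable)
  have IH: "integrable M (\<lambda>\<omega>. (\<Sum>i\<in>I. Z i \<omega>)\<^sup>2)"
    "expectation (\<lambda>\<omega>. (\<Sum>i\<in>I. Z i \<omega>)\<^sup>2) = (\<Sum>i\<in>I. expectation (\<lambda>\<omega>. (Z i \<omega>)\<^sup>2))"
    using insert.IH[OF indep_vars_subset[OF insert.prems(1)]] insert.prems(2,3) by auto
  have ind: "indep_var borel (Z j) borel (\<lambda>\<omega>. \<Sum>i\<in>I. Z i \<omega>)"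
    using insert.hyps insert.prems(1) by (rule indep_vars_sum)
  have intS: "integrable M (\<lambda>\<omega>. \<Sum>i\<in>I. Z i \<omega>)" and intj: "integrable M (Z j)"
    using int by auto
  have prod: "integrable M (\<lambda>\<omega>. Z j \<omega> * (\<Sum>i\<in>I. Z i \<omega>))"
    "expectation (\<lambda>\<omega>. Z j \<omega> * (\<Sum>i\<in>I. Z i \<omega>)) = 0"
    using indep_var_integrable[OF ind intj intS] indep_var_lebesgue_integral[OF ind intj intS]
      insert.prems(3)[of j] by auto
  have eq: "(\<Sum>i\<in>insert j I. Z i \<omega>)\<^sup>2 =
      (Z j \<omega>)\<^sup>2 + (\<Sum>i\<in>I. Z i \<omega>)\<^sup>2 + 2 * (Z j \<omega> * (\<Sum>i\<in>I. Z i \<omega>))" for \<omega>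
    using insert.hyps by (simp add: power2_sum)
  show ?case
    unfolding eq using insert.hyps insert.prems(2)[of j] IH prod by simp
qed simp

lemma (in prob_space) variance_sum_indep:
  fixes Y :: "'i \<Rightarrow> 'a \<Rightarrow> real"
  assumes "finite I" "indep_vars (\<lambda>_. borel) Y I"
    and sq: "\<And>i. i \<in> I \<Longrightarrow> integrable M (\<lambda>\<omega>. (Y i \<omega>)\<^sup>2)"
  shows "integrable M (\<lambda>\<omega>. (\<Sum>i\<in>I. Y i \<omega>)\<^sup>2)"
    "variance (\<lambda>\<omega>. \<Sum>i\<in>I. Y i \<omega>) = (\<Sum>i\<in>I. variance (Y i))"
proof -
  define Z where "Z i \<omega> = Y i \<omega> - expectation (Y i)" for i \<omega>
  have rv: "random_variable borel (Y i)" if "i \<in> I" for i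
    using assms(2) that by (auto simp: indep_vars_def)
  have int: "integrable M (Y i)" if "i \<in> I" for i
    using rv[OF that] sq[OF that] by (rule square_integrable_imp_integrable)
  have "indep_vars (\<lambda>_. borel) Z I"
    unfolding Z_def by (rule indep_vars_compose2[OF assms(2)]) simp
  moreover have "integrable M (\<lambda>\<omega>. (Z i \<omega>)\<^sup>2)" "expectation (Z i) = 0" if "i \<in> I" for i
    using int[OF that] sq[OF that] by (simp_all add: Z_def[abs_def] power2_diff prob_space)
  ultimately have Z: "integrable M (\<lambda>\<omega>. (\<Sum>i\<in>I. Z i \<omega>)\<^sup>2)"
    "expectation (\<lambda>\<omega>. (\<Sum>i\<in>I. Z i \<omega>)\<^sup>2) = (\<Sum>i\<in>I. expectation (\<lambda>\<omega>. (Z i \<omega>)\<^sup>2))"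
    using second_moment_centered_sum[OF assms(1), of Z] by auto
  let ?c = "\<Sum>i\<in>I. expectation (Y i)"
  have "expectation (\<lambda>\<omega>. \<Sum>i\<in>I. Y i \<omega>) = ?c" using int by simp
  then show "variance (\<lambda>\<omega>. \<Sum>i\<in>I. Y i \<omega>) = (\<Sum>i\<in>I. variance (Y i))"
    using Z(2) by (simp add: Z_def sum_subtractf)
  have intZ: "integrable M (\<lambda>\<omega>. \<Sum>i\<in>I. Z i \<omega>)"
    unfolding Z_def using int by (intro Bochner_Integration.integrable_sum) simp
  have "(\<Sum>i\<in>I. Y i \<omega>)\<^sup>2 = (\<Sum>i\<in>I. Z i \<omega>)\<^sup>2 + 2 * ?c * (\<Sum>i\<in>I. Z i \<omega>) + ?c\<^sup>2" for \<omega>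
    by (simp add: Z_def sum_subtractf power2_eq_square algebra_simps)
  then show "integrable M (\<lambda>\<omega>. (\<Sum>i\<in>I. Y i \<omega>)\<^sup>2)"
    using Z(1) intZ by simp
qed

text \<open>An edge is determined by its left endpoint \<open>i < n\<close> and its length, so
  \<open>[0, n]\<close> has at most \<open>n\<close> edges of each length. Pairs that leave the
  interval are harmless because \<open>h\<close> is nonnegative there.\<close>

lemma sum_edges_in_le:
  fixes h :: "int \<Rightarrow> real"
  assumes "\<And>l. 0 < l \<Longrightarrow> 0 \<le> h l"
  shows "(\<Sum>e\<in>edges_in 0 (int n + 1). h (snd e - fst e)) \<le> real n * (\<Sum>l = 1..n. h (int l))"
proof -
  let ?f = "\<lambda>(i, l). (int i, int i + int l)"
  let ?P = "{..<n} \<times> {1..n}"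
  have "edges_in 0 (int n + 1) \<subseteq> ?f ` ?P"
  proof
    fix e assume "e \<in> edges_in 0 (int n + 1)"
    then obtain i j where e: "e = (i, j)" "0 \<le> i" "i < j" "j \<le> int n" by (auto simp: edges_in_def)
    then have "e = ?f (nat i, nat (j - i))" "(nat i, nat (j - i)) \<in> ?P" by auto
    then show "e \<in> ?f ` ?P" by blast
  qed
  then have "(\<Sum>e\<in>edges_in 0 (int n + 1). h (snd e - fst e)) \<le> (\<Sum>e\<in>?f ` ?P. h (snd e - fst e))"
    using assms by (intro sum_mono2) auto
  also have "\<dots> = (\<Sum>(i, l)\<in>?P. h (int l))"
    by (subst sum.reindex) (auto simp: inj_on_def case_prod_unfold)
  also have "\<dots> = real n * (\<Sum>l = 1..n. h (int l))"
    by (simp add: sum.cartesian_product[symmetric])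
  finally show ?thesis .
qed

definition exc :: "real \<Rightarrow> real \<Rightarrow> int \<Rightarrow> real \<Rightarrow> real" where
  "exc K \<epsilon> l x = max 0 (x - K - \<epsilon> * real_of_int l)"

lemma exc_nonneg [simp]: "0 \<le> exc K \<epsilon> l x" by (simp add: exc_def)

lemma borel_measurable_exc [measurable]: "exc K \<epsilon> l \<in> borel_measurable borel"
  unfolding exc_def by measurable

lemma le_cut_add_exc:
  assumes "0 \<le> \<epsilon> * real_of_int l"
  shows "x \<le> cut K x + \<epsilon> * real_of_int l + exc K \<epsilon> l x"
  using assms by (auto simp: cut_def exc_def max_def min_def)

text \<open>This bound is where the second moment of the weights enters.\<close>

lemma sum_exc_le:
  assumes "0 < \<epsilon>"
  shows "(\<Sum>l = 1..L. exc K \<epsilon> (int l) x) \<le> (max 0 (x - K))\<^sup>2 / \<epsilon>"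
proof -
  define y where "y = max 0 (x - K)"
  have y: "0 \<le> y" by (simp add: y_def)
  \<comment> \<open>The term for length \<open>l\<close> vanishes unless
    \<open>\<epsilon> * l < y\<close> and never exceeds \<open>y\<close>; at most
    \<open>y / \<epsilon>\<close> lengths qualify, hence the square.\<close>
  have "exc K \<epsilon> (int l) x \<le> (if \<epsilon> * real l < y then y else 0)" for l
  proof -
    have "0 \<le> \<epsilon> * real l" using assms by simp
    then show ?thesis by (auto simp: exc_def y_def max_def)
  qed
  then have "(\<Sum>l = 1..L. exc K \<epsilon> (int l) x) \<le> (\<Sum>l = 1..L. if \<epsilon> * real l < y then y else 0)"
    by (intro sum_mono)
  also have "\<dots> = real (card {l \<in> {1..L}. \<epsilon> * real l < y}) * y"
    by (simp add: sum.If_cases Int_def)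
  also have "\<dots> \<le> y / \<epsilon> * y"
  proof (rule mult_right_mono[OF _ y])
    have "{l \<in> {1..L}. \<epsilon> * real l < y} \<subseteq> {1..nat \<lfloor>y / \<epsilon>\<rfloor>}"
      using assms y by (auto simp: le_nat_iff le_floor_iff field_simps)
    then have "card {l \<in> {1..L}. \<epsilon> * real l < y} \<le> nat \<lfloor>y / \<epsilon>\<rfloor>"
      using card_mono[of "{1..nat \<lfloor>y / \<epsilon>\<rfloor>}"] by simp
    moreover have "real (nat \<lfloor>y / \<epsilon>\<rfloor>) \<le> y / \<epsilon>" using assms y by simp
    ultimately show "real (card {l \<in> {1..L}. \<epsilon> * real l < y}) \<le> y / \<epsilon>" by linarith
  qed
  finally show ?thesis by (simp add: y_def power2_eq_square)
qed

text \<open>Terms with \<open>2^k \<le> u\<close> form an increasing geometric sum of at most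
  \<open>2 * u\<close>; the others equal \<open>u^2 / 2^k\<close> and also sum to at most
  \<open>2 * u\<close>.\<close>

lemma sum_dyadic_min_le:
  fixes u :: real
  assumes "0 \<le> u"
  shows "(\<Sum>k<R. (min u (2 ^ k))\<^sup>2 / 2 ^ k) \<le> 4 * u"
proof -
  have less: "(\<Sum>k<R. (min u (2 ^ k))\<^sup>2 / 2 ^ k) \<le> 2 ^ R" for R
  proof (induction R)
    case (Suc R)
    have "(min u (2 ^ R))\<^sup>2 / 2 ^ R \<le> (2 ^ R)\<^sup>2 / 2 ^ R"
      using assms by (intro divide_right_mono power_mono) auto
    with Suc show ?case by (simp add: power2_eq_square)
  qed simp
  \<comment> \<open>The subtracted term is the geometric tail of \<open>u^2 / 2^k\<close> over
    \<open>k \<ge> R\<close>; keeping it in the invariant makes the induction exact once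
    \<open>2^R\<close> exceeds \<open>u\<close>.\<close>
  have "2 ^ R \<le> u \<or> (\<Sum>k<R. (min u (2 ^ k))\<^sup>2 / 2 ^ k) \<le> 4 * u - 2 * u\<^sup>2 / 2 ^ R"
  proof (induction R)
    case 0
    show ?case
    proof (cases "1 \<le> u")
      case False
      then have "u * u \<le> 1 * u" using assms by (intro mult_right_mono) auto
      with assms have "u * u \<le> 2 * u" by linarith
      then show ?thesis by (simp add: power2_eq_square)
    qed simp
  next
    case (Suc R)
    show ?case
    proof (cases "2 ^ R \<le> u")
      case True
      define t :: real where "t = 2 ^ Suc R"
      \<comment> \<open>The moment of crossing, where \<open>u < t \<le> 2 * u\<close>: the
        invariant is entered from the crude bound \<open>less\<close>, by expanding
        \<open>(2 * u - t) * (t - u) \<ge> 0\<close>.\<close>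
      have "t \<le> 4 * u - 2 * u\<^sup>2 / t" if "u < t"
      proof -
        have "t > 0" "t \<le> 2 * u" using True by (auto simp: t_def)
        have "0 \<le> (2 * u - t) * (t - u)" using \<open>t \<le> 2 * u\<close> that by (intro mult_nonneg_nonneg) auto
        moreover have "0 \<le> u * t" using assms \<open>0 < t\<close> by simp
        ultimately have "t * t \<le> 4 * u * t - 2 * u\<^sup>2"
          by (simp add: algebra_simps power2_eq_square)
        then have "t \<le> (4 * u * t - 2 * u\<^sup>2) / t" using \<open>0 < t\<close> by (simp add: le_divide_eq)
        also have "\<dots> = 4 * u - 2 * u\<^sup>2 / t" using \<open>0 < t\<close> by (simp add: diff_divide_distrib)
        finally show ?thesis .
      qed
      with less[of "Suc R"] show ?thesis unfolding t_def by linarith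
    next
      case False
      then have "(min u (2 ^ R))\<^sup>2 / 2 ^ R = u\<^sup>2 / 2 ^ R" by (simp add: min_def)
      with False Suc show ?thesis by simp
    qed
  qed
  then show ?thesis
  proof
    assume "2 ^ R \<le> u"
    with less[of R] assms show ?thesis by linarith
  next
    assume "(\<Sum>k<R. (min u (2 ^ k))\<^sup>2 / 2 ^ k) \<le> 4 * u - 2 * u\<^sup>2 / 2 ^ R"
    moreover have "0 \<le> 2 * u\<^sup>2 / 2 ^ R" by simp
    ultimately show ?thesis by linarith
  qed
qed

section \<open>The total excess of the edges in \<open>[0, n]\<close>\<close>

context weighted_random_digraph
begin

definition excess :: "real \<Rightarrow> real \<Rightarrow> int \<times> int \<Rightarrow> 'a \<Rightarrow> real" where
  "excess K \<epsilon> e \<omega> = exc K \<epsilon> (snd e - fst e) (v e \<omega>)"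

definition total_excess :: "real \<Rightarrow> real \<Rightarrow> nat \<Rightarrow> 'a \<Rightarrow> real" where
  "total_excess K \<epsilon> n \<omega> = (\<Sum>e\<in>edges_in 0 (int n + 1). excess K \<epsilon> e \<omega>)"

lemma excess_nonneg [simp]: "0 \<le> excess K \<epsilon> e \<omega>" by (simp add: excess_def)

lemma excess_measurable: "e \<in> edges \<Longrightarrow> random_variable borel (excess K \<epsilon> e)"
  unfolding excess_def using v_measurable by measurable

lemma total_excess_mono: "n \<le> m \<Longrightarrow> total_excess K \<epsilon> n \<omega> \<le> total_excess K \<epsilon> m \<omega>"
  unfolding total_excess_def by (rule sum_mono2[OF finite_edges_in]) (auto simp: edges_in_def)

lemma path_weight_le_cut:
  assumes "0 < \<epsilon>" "is_path E 0 (int n) xs"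
  shows "path_weight (\<lambda>e. v e \<omega>) xs \<le>
    path_weight (\<lambda>e. cut K (v e \<omega>)) xs + \<epsilon> * real n + total_excess K \<epsilon> n \<omega>"
proof -
  have xs: "xs \<in> increasing_lists 0 (int n + 1)"
    using assms(2) by (rule path_in_increasing_lists)
  let ?l = "\<lambda>(i, j). real_of_int (j - i)"
  have "path_weight (\<lambda>e. v e \<omega>) xs \<le>
      path_weight (\<lambda>e. cut K (v e \<omega>) + \<epsilon> * ?l e + excess K \<epsilon> e \<omega>) xs"
  proof (rule path_weight_mono_edges[OF xs])
    fix e assume "e \<in> edges_in 0 (int n + 1)"
    then have "0 \<le> \<epsilon> * real_of_int (snd e - fst e)" using assms(1) by (auto simp: edges_in_def)
    from le_cut_add_exc[OF this]
    show "v e \<omega> \<le> cut K (v e \<omega>) + \<epsilon> * ?l e + excess K \<epsilon> e \<omega>"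
      by (simp add: excess_def case_prod_unfold)
  qed
  also have "\<dots> = path_weight (\<lambda>e. cut K (v e \<omega>)) xs + \<epsilon> * path_weight ?l xs
      + path_weight (\<lambda>e. excess K \<epsilon> e \<omega>) xs"
    by (simp only: path_weight_add path_weight_cmult)
  also have "path_weight ?l xs = real n"
    using assms(2) by (subst path_weight_length) (auto simp: is_path_def)
  also have "path_weight (\<lambda>e. excess K \<epsilon> e \<omega>) xs \<le> total_excess K \<epsilon> n \<omega>"
    unfolding total_excess_def by (intro path_weight_le_sum[OF xs]) simp
  finally show ?thesis by simp
qed

definition tail_moment :: "real \<Rightarrow> real" where
  "tail_moment K = (\<integral>x. (max 0 (x - K))\<^sup>2 \<partial>\<nu>)"

end

locale weighted_random_digraph_L2 = weighted_random_digraph +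
  assumes second_moment: "integrable \<nu> (\<lambda>x. x\<^sup>2)"
begin

sublocale law: prob_space \<nu> by (rule prob_space_law)

lemma excess_sq_le: "0 \<le> K \<Longrightarrow> (max 0 (x - K))\<^sup>2 \<le> x\<^sup>2" for x :: real
  by (rule abs_le_square_iff[THEN iffD1]) auto

lemma integrable_excess_sq: "0 \<le> K \<Longrightarrow> integrable \<nu> (\<lambda>x. (max 0 (x - K))\<^sup>2)"
  by (rule Bochner_Integration.integrable_bound[OF second_moment]) (auto simp: excess_sq_le)

lemma integrable_law: "integrable \<nu> (\<lambda>x. x)"
  by (rule law.square_integrable_imp_integrable[OF _ second_moment]) simp

lemma integrable_v: "e \<in> edges \<Longrightarrow> integrable M (v e)"
  by (rule integrable_v_iff[THEN iffD2, OF _ measurable_ident_sets[OF refl] integrable_law])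

lemma integrable_exc: "0 \<le> K \<Longrightarrow> 0 \<le> \<epsilon> * real_of_int l \<Longrightarrow> integrable \<nu> (exc K \<epsilon> l)"
  by (rule Bochner_Integration.integrable_bound[OF integrable_law])
     (auto simp: exc_def)

lemma integrable_excess:
  assumes "0 \<le> K" "0 \<le> \<epsilon>" "e \<in> edges"
  shows "integrable M (excess K \<epsilon> e)"
  unfolding excess_def
  using assms by (subst integrable_v_iff) (auto intro!: integrable_exc simp: edges_def)

lemma tail_moment_LIMSEQ: "(\<lambda>n. tail_moment (real n)) \<longlonglongrightarrow> 0"
proof -
  have "(\<lambda>n. \<integral>x. (max 0 (x - real n))\<^sup>2 \<partial>\<nu>) \<longlonglongrightarrow> (\<integral>x. 0 \<partial>\<nu>)"
  proof (rule integral_dominated_convergence[OF _ _ second_moment])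
    show "AE x in \<nu>. (\<lambda>n. (max 0 (x - real n))\<^sup>2) \<longlonglongrightarrow> 0"
    proof (rule AE_I2)
      fix x
      have "\<forall>\<^sub>F n in sequentially. x \<le> real n"
        using eventually_ge_at_top[of "nat \<lceil>x\<rceil>"] by eventually_elim linarith
      then have "\<forall>\<^sub>F n in sequentially. (max 0 (x - real n))\<^sup>2 = 0"
        by eventually_elim simp
      then show "(\<lambda>n. (max 0 (x - real n))\<^sup>2) \<longlonglongrightarrow> 0"
        by (rule tendsto_eventually)
    qed
  qed (auto simp: excess_sq_le)
  then show ?thesis by (simp add: tail_moment_def)
qed

text \<open>Uniform in \<open>L\<close>; this keeps the mean total excess linear in
  \<open>n\<close>, although the number of edges is quadratic.\<close>

lemma sum_integral_exc_le:
  assumes "0 \<le> K" "0 < \<epsilon>"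
  shows "(\<Sum>l = 1..L. \<integral>x. exc K \<epsilon> (int l) x \<partial>\<nu>) \<le> tail_moment K / \<epsilon>"
proof -
  have int: "integrable \<nu> (exc K \<epsilon> (int l))" for l
    using assms by (intro integrable_exc) auto
  then have "(\<Sum>l = 1..L. \<integral>x. exc K \<epsilon> (int l) x \<partial>\<nu>) = (\<integral>x. (\<Sum>l = 1..L. exc K \<epsilon> (int l) x) \<partial>\<nu>)"
    by (simp add: Bochner_Integration.integral_sum)
  also have "\<dots> \<le> (\<integral>x. (max 0 (x - K))\<^sup>2 / \<epsilon> \<partial>\<nu>)"
    using assms int integrable_excess_sq[of K] sum_exc_le[of \<epsilon> K]
    by (intro integral_mono Bochner_Integration.integrable_sum) auto
  also have "\<dots> = tail_moment K / \<epsilon>" by (simp add: tail_moment_def)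
  finally show ?thesis .
qed

lemma expectation_total_excess:
  assumes "0 \<le> K" "0 < \<epsilon>"
  shows "integrable M (total_excess K \<epsilon> n)" "expectation (total_excess K \<epsilon> n) \<le> real n * (tail_moment K / \<epsilon>)"
proof -
  have int: "integrable M (excess K \<epsilon> e)" if "e \<in> edges_in 0 (int n + 1)" for e
    using assms that edges_in_subset_edges by (intro integrable_excess) auto
  then show "integrable M (total_excess K \<epsilon> n)"
    unfolding total_excess_def[abs_def] by (rule Bochner_Integration.integrable_sum)
  have "expectation (total_excess K \<epsilon> n) = (\<Sum>e\<in>edges_in 0 (int n + 1). expectation (excess K \<epsilon> e))"
    unfolding total_excess_def[abs_def] using int by (rule Bochner_Integration.integral_sum)
  also have "\<dots> = (\<Sum>e\<in>edges_in 0 (int n + 1). \<integral>x. exc K \<epsilon> (snd e - fst e) x \<partial>\<nu>)"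
    unfolding excess_def[abs_def] using edges_in_subset_edges
    by (intro sum.cong refl expectation_v) auto
  also have "\<dots> \<le> real n * (\<Sum>l = 1..n. \<integral>x. exc K \<epsilon> (int l) x \<partial>\<nu>)"
    by (rule sum_edges_in_le) simp
  also have "\<dots> \<le> real n * (tail_moment K / \<epsilon>)"
    using sum_integral_exc_le[OF assms] by (rule mult_left_mono) simp
  finally show "expectation (total_excess K \<epsilon> n) \<le> real n * (tail_moment K / \<epsilon>)" .
qed

end

section \<open>Almost sure control of the total excess along powers of two\<close>

context weighted_random_digraph_L2
begin

text \<open>Up to the factor \<open>1 / \<eta>^2\<close>, Chebyshev's bound at scale
  \<open>2^k\<close> after truncation at \<open>2^k\<close>. Untruncated second moments would give a
  sum over \<open>k\<close> of the order of E v^2 log v, which may be infinite.\<close>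

definition truncated_moment :: "real \<Rightarrow> real \<Rightarrow> nat \<Rightarrow> real" where
  "truncated_moment K \<epsilon> k =
     (\<Sum>e\<in>edges_in 0 (int (2 ^ k) + 1). expectation (\<lambda>\<omega>. (min (excess K \<epsilon> e \<omega>) (2 ^ k))\<^sup>2)) / 4 ^ k"

lemma truncated_moment_nonneg: "0 \<le> truncated_moment K \<epsilon> k"
  unfolding truncated_moment_def by (intro divide_nonneg_nonneg sum_nonneg Bochner_Integration.integral_nonneg) auto

text \<open>The sums over scales and lengths are interchanged. For fixed \<open>l\<close>,
  \<open>sum_dyadic_min_le\<close> reduces the truncated squares to the first power of the excess,
  and the sum over \<open>l\<close> is again at most
  \<open>tail_moment K / \<epsilon>\<close>.\<close>

lemma summable_truncated_moment:
  assumes "0 \<le> K" "0 < \<epsilon>"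
  shows "summable (truncated_moment K \<epsilon>)"
proof (rule summableI_nonneg_bounded)
  fix R
  let ?g = "\<lambda>l k x. (min (exc K \<epsilon> (int l) x) (2 ^ k))\<^sup>2 / 2 ^ k :: real"
  have int_g: "integrable \<nu> (?g l k)" for l k
  proof (rule law.integrable_const_bound[where B = "2 ^ k"])
    have "(min (exc K \<epsilon> (int l) x) (2 ^ k))\<^sup>2 \<le> (2 ^ k)\<^sup>2" for x
      by (intro power_mono) auto
    then have "?g l k x \<le> (2 ^ k)\<^sup>2 / 2 ^ k" for x
      by (intro divide_right_mono) auto
    then show "AE x in \<nu>. norm (?g l k x) \<le> 2 ^ k"
      by (intro AE_I2) (simp add: power2_eq_square)
  qed simp
  have "truncated_moment K \<epsilon> k \<le> (\<Sum>l = 1..2 ^ k. \<integral>x. ?g l k x \<partial>\<nu>)" for k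
  proof -
    let ?h = "\<lambda>l. \<integral>x. (min (exc K \<epsilon> l x) (2 ^ k))\<^sup>2 \<partial>\<nu>"
    have "(\<Sum>e\<in>edges_in 0 (int (2 ^ k) + 1). expectation (\<lambda>\<omega>. (min (excess K \<epsilon> e \<omega>) (2 ^ k))\<^sup>2))
        = (\<Sum>e\<in>edges_in 0 (int (2 ^ k) + 1). ?h (snd e - fst e))"
      unfolding excess_def using edges_in_subset_edges
      by (intro sum.cong refl expectation_v[where f = "\<lambda>x. (min (exc K \<epsilon> _ x) (2 ^ k))\<^sup>2"]) auto
    also have "\<dots> \<le> real (2 ^ k) * (\<Sum>l = 1..2 ^ k. ?h (int l))"
      by (rule sum_edges_in_le) simp
    finally have "truncated_moment K \<epsilon> k \<le> real (2 ^ k) * (\<Sum>l = 1..2 ^ k. ?h (int l)) / 4 ^ k"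
      unfolding truncated_moment_def by (rule divide_right_mono) simp
    \<comment> \<open>One of the two factors cancels against the number \<open>2^k\<close> of edges
      of each length.\<close>
    also have "(4::real) ^ k = 2 ^ k * 2 ^ k"
      by (simp flip: power_mult_distrib)
    also have "real (2 ^ k) * (\<Sum>l = 1..2 ^ k. ?h (int l)) / (2 ^ k * 2 ^ k) = (\<Sum>l = 1..2 ^ k. ?h (int l) / 2 ^ k)"
      by (simp add: sum_divide_distrib)
    finally show ?thesis by simp
  qed
  then have "(\<Sum>k<R. truncated_moment K \<epsilon> k) \<le> (\<Sum>k<R. \<Sum>l = 1..2 ^ k. \<integral>x. ?g l k x \<partial>\<nu>)"
    by (rule sum_mono)
  \<comment> \<open>The range of \<open>l\<close> is enlarged to one independent of
    \<open>k\<close>, as the interchange of sums requires.\<close>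
  also have "\<dots> \<le> (\<Sum>k<R. \<Sum>l = 1..2 ^ R. \<integral>x. ?g l k x \<partial>\<nu>)"
  proof (rule sum_mono)
    fix k assume "k \<in> {..<R}"
    then have "(2::nat) ^ k \<le> 2 ^ R" by (intro power_increasing) auto
    then show "(\<Sum>l = 1..2 ^ k. \<integral>x. ?g l k x \<partial>\<nu>) \<le> (\<Sum>l = 1..2 ^ R. \<integral>x. ?g l k x \<partial>\<nu>)"
      by (intro sum_mono2 Bochner_Integration.integral_nonneg) auto
  qed
  also have "\<dots> = (\<Sum>l = 1..2 ^ R. \<Sum>k<R. \<integral>x. ?g l k x \<partial>\<nu>)"
    by (rule sum.swap)
  also have "\<dots> = (\<Sum>l = 1..2 ^ R. \<integral>x. (\<Sum>k<R. ?g l k x) \<partial>\<nu>)"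
    using int_g by (intro sum.cong refl Bochner_Integration.integral_sum[symmetric]) auto
  also have "\<dots> \<le> (\<Sum>l = 1..2 ^ R. \<integral>x. 4 * exc K \<epsilon> (int l) x \<partial>\<nu>)"
  proof (rule sum_mono, rule integral_mono)
    fix l
    show "integrable \<nu> (\<lambda>x. \<Sum>k<R. ?g l k x)" by (intro Bochner_Integration.integrable_sum int_g)
    show "integrable \<nu> (\<lambda>x. 4 * exc K \<epsilon> (int l) x)"
      using assms by (intro integrable_mult_right integrable_exc) auto
  qed (rule sum_dyadic_min_le, rule exc_nonneg)
  also have "\<dots> = 4 * (\<Sum>l = 1..2 ^ R. \<integral>x. exc K \<epsilon> (int l) x \<partial>\<nu>)"
    by (simp add: sum_distrib_left)
  also have "\<dots> \<le> 4 * (tail_moment K / \<epsilon>)"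
    using sum_integral_exc_le[OF assms] by (intro mult_left_mono) auto
  finally show "(\<Sum>k<R. truncated_moment K \<epsilon> k) \<le> 4 * (tail_moment K / \<epsilon>)" .
qed (rule truncated_moment_nonneg)

text \<open>Either the truncated sum deviates from its mean by at least \<open>\<eta> * 2^k\<close>,
  which Chebyshev's inequality controls, or some excess is above \<open>2^k\<close>, where the
  truncated square divided by \<open>4^k\<close> equals 1. The two cases give the summands
  \<open>1 / \<eta>^2\<close> and 1.\<close>

lemma total_excess_dyadic_prob:
  assumes "0 \<le> K" "0 < \<epsilon>" "0 < \<eta>"
  shows "prob {\<omega> \<in> space M. (tail_moment K / \<epsilon> + \<eta>) * 2 ^ k < total_excess K \<epsilon> (2 ^ k) \<omega>}
    \<le> (1 / \<eta>\<^sup>2 + 1) * truncated_moment K \<epsilon> k"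
proof -
  define E where "E = edges_in 0 (int (2 ^ k) + 1)"
  define Y where "Y e \<omega> = min (excess K \<epsilon> e \<omega>) (2 ^ k)" for e \<omega>
  define T where "T \<omega> = (\<Sum>e\<in>E. Y e \<omega>)" for \<omega>
  define V where "V e = expectation (\<lambda>\<omega>. (Y e \<omega>)\<^sup>2)" for e
  have E: "finite E" "E \<subseteq> edges" by (simp_all add: E_def edges_in_subset_edges)
  have moment: "truncated_moment K \<epsilon> k = (\<Sum>e\<in>E. V e) / 4 ^ k"
    by (simp add: truncated_moment_def E_def V_def Y_def)
  have rv_ex [measurable]: "random_variable borel (excess K \<epsilon> e)" if "e \<in> E" for e
    using E(2) that by (intro excess_measurable) auto
  have rv [measurable]: "random_variable borel (Y e)" if "e \<in> E" for e
    unfolding Y_def using rv_ex[OF that] by simp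
  have rvT [measurable]: "random_variable borel T"
    unfolding T_def by (intro borel_measurable_sum rv)
  have Y_bounds: "0 \<le> Y e \<omega>" "Y e \<omega> \<le> 2 ^ k" for e \<omega> by (simp_all add: Y_def)
  have sq_bound: "(Y e \<omega>)\<^sup>2 \<le> (2 ^ k)\<^sup>2" for e \<omega>
    using Y_bounds by (intro power_mono)
  have int: "integrable M (Y e)" "integrable M (\<lambda>\<omega>. (Y e \<omega>)\<^sup>2)" if "e \<in> E" for e
  proof -
    show "integrable M (Y e)"
      by (rule integrable_const_bound[where B = "2 ^ k"]) (use rv[OF that] Y_bounds in auto)
    show "integrable M (\<lambda>\<omega>. (Y e \<omega>)\<^sup>2)"
      by (rule integrable_const_bound[where B = "(2 ^ k)\<^sup>2"]) (use rv[OF that] sq_bound in auto)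
  qed
  have ind: "indep_vars (\<lambda>_. borel) Y E"
    unfolding Y_def[abs_def] excess_def
    by (rule indep_vars_compose2[OF indep_vars_subset[OF indep_weights E(2)],
        where Y = "\<lambda>e x. min (exc K \<epsilon> (snd e - fst e) x) (2 ^ k)"]) simp
  let ?A1 = "{\<omega> \<in> space M. \<eta> * 2 ^ k \<le> \<bar>T \<omega> - expectation T\<bar>}"
  let ?A2 = "\<lambda>e. {\<omega> \<in> space M. 2 ^ k < excess K \<epsilon> e \<omega>}"
  have four: "(2 ^ k)\<^sup>2 = (4::real) ^ k" by (simp add: power2_eq_square flip: power_mult_distrib)
  have "prob ?A1 \<le> variance T / (\<eta> * 2 ^ k)\<^sup>2"
    using assms(3) variance_sum_indep(1)[OF E(1) ind int(2)]
    by (intro Chebyshev_inequality) (auto simp: T_def)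
  also have "variance T = (\<Sum>e\<in>E. variance (Y e))"
    unfolding T_def[abs_def] by (rule variance_sum_indep(2)[OF E(1) ind int(2)])
  also have "(\<Sum>e\<in>E. variance (Y e)) \<le> (\<Sum>e\<in>E. V e)"
    using int by (intro sum_mono) (simp add: variance_eq V_def)
  then have "(\<Sum>e\<in>E. variance (Y e)) / (\<eta> * 2 ^ k)\<^sup>2 \<le> (\<Sum>e\<in>E. V e) / (\<eta> * 2 ^ k)\<^sup>2"
    by (rule divide_right_mono) simp
  also have "\<dots> = 1 / \<eta>\<^sup>2 * truncated_moment K \<epsilon> k"
    by (simp add: moment power_mult_distrib four)
  finally have A1: "prob ?A1 \<le> 1 / \<eta>\<^sup>2 * truncated_moment K \<epsilon> k" .
  have A2_event: "?A2 e \<in> events" if "e \<in> E" for e using rv_ex[OF that] by simp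
  have A2: "prob (?A2 e) \<le> V e / 4 ^ k" if "e \<in> E" for e
  proof -
    have "prob (?A2 e) = expectation (indicator (?A2 e))" using A2_event[OF that] by simp
    also have "\<dots> \<le> expectation (\<lambda>\<omega>. (Y e \<omega>)\<^sup>2 / 4 ^ k)"
    proof (rule integral_mono)
      show "integrable M (indicator (?A2 e) :: 'a \<Rightarrow> real)"
        using A2_event[OF that] by (simp add: emeasure_eq_measure)
      show "integrable M (\<lambda>\<omega>. (Y e \<omega>)\<^sup>2 / 4 ^ k)" using int(2)[OF that] by simp
      show "indicator (?A2 e) \<omega> \<le> (Y e \<omega>)\<^sup>2 / 4 ^ k" for \<omega>
        by (auto simp: indicator_def Y_def min_def four)
    qed
    finally show ?thesis by (simp add: V_def)
  qed
  \<comment> \<open>Truncation only lowers the mean, so the bound on the mean total excess applies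
    to \<open>T\<close> as well.\<close>
  have "expectation T \<le> expectation (total_excess K \<epsilon> (2 ^ k))"
  proof (rule integral_mono[OF _ expectation_total_excess(1)[OF assms(1,2)]])
    show "integrable M T" unfolding T_def[abs_def] using int(1) by (rule Bochner_Integration.integrable_sum)
    show "T \<omega> \<le> total_excess K \<epsilon> (2 ^ k) \<omega>" for \<omega>
      unfolding T_def total_excess_def E_def by (auto simp: Y_def intro!: sum_mono)
  qed
  also have "\<dots> \<le> tail_moment K / \<epsilon> * 2 ^ k"
    using expectation_total_excess(2)[OF assms(1,2), of "2 ^ k"] by (simp add: mult.commute)
  finally have ET: "expectation T \<le> tail_moment K / \<epsilon> * 2 ^ k" .
  have "{\<omega> \<in> space M. (tail_moment K / \<epsilon> + \<eta>) * 2 ^ k < total_excess K \<epsilon> (2 ^ k) \<omega>} \<subseteq> ?A1 \<union> (\<Union>e\<in>E. ?A2 e)"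
  proof
    fix \<omega> assume \<omega>: "\<omega> \<in> {\<omega> \<in> space M. (tail_moment K / \<epsilon> + \<eta>) * 2 ^ k < total_excess K \<epsilon> (2 ^ k) \<omega>}"
    show "\<omega> \<in> ?A1 \<union> (\<Union>e\<in>E. ?A2 e)"
    proof (cases "\<exists>e\<in>E. 2 ^ k < excess K \<epsilon> e \<omega>")
      case False
      then have "total_excess K \<epsilon> (2 ^ k) \<omega> = T \<omega>"
        unfolding total_excess_def T_def E_def[symmetric] by (intro sum.cong) (auto simp: Y_def E_def)
      with \<omega> ET have "\<omega> \<in> ?A1" by (auto simp: algebra_simps)
      then show ?thesis by blast
    qed (use \<omega> in auto)
  qed
  then have "prob {\<omega> \<in> space M. (tail_moment K / \<epsilon> + \<eta>) * 2 ^ k < total_excess K \<epsilon> (2 ^ k) \<omega>}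
      \<le> prob (?A1 \<union> (\<Union>e\<in>E. ?A2 e))"
    using A2_event E(1) by (intro finite_measure_mono sets.Un sets.finite_UN) auto
  also have "\<dots> \<le> prob ?A1 + prob (\<Union>e\<in>E. ?A2 e)"
    using A2_event E(1) by (intro measure_Un_le sets.finite_UN) auto
  also have "prob (\<Union>e\<in>E. ?A2 e) \<le> (\<Sum>e\<in>E. prob (?A2 e))"
    using A2_event E(1) by (intro finite_measure_subadditive_finite) auto
  also have "\<dots> \<le> (\<Sum>e\<in>E. V e / 4 ^ k)" by (intro sum_mono A2)
  also have "\<dots> = truncated_moment K \<epsilon> k" by (simp add: moment sum_divide_distrib)
  finally show ?thesis using A1 by (simp add: algebra_simps)
qed

text \<open>The total excess increases with \<open>n\<close>, so between two powers of two it is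
  bounded by its value at the larger one; this costs the factor 2.\<close>

lemma total_excess_AE:
  assumes "0 \<le> K" "0 < \<epsilon>" "0 < \<eta>"
  shows "AE \<omega> in M. \<forall>\<^sub>F n in sequentially. total_excess K \<epsilon> n \<omega> \<le> 2 * (tail_moment K / \<epsilon> + \<eta>) * real n"
proof -
  let ?c = "tail_moment K / \<epsilon> + \<eta>"
  have c: "0 \<le> ?c"
    using assms by (intro add_nonneg_nonneg divide_nonneg_nonneg) (auto simp: tail_moment_def)
  have rv [measurable]: "random_variable borel (total_excess K \<epsilon> n)" for n
    using expectation_total_excess(1)[OF assms(1,2)] by auto
  have "AE \<omega> in M. \<forall>\<^sub>F k in sequentially.
      \<omega> \<notin> {\<omega> \<in> space M. ?c * 2 ^ k < total_excess K \<epsilon> (2 ^ k) \<omega>}"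
    by (rule borel_cantelli_prob[OF _ total_excess_dyadic_prob[OF assms]])
       (auto intro!: summable_mult summable_truncated_moment assms)
  then show ?thesis
  proof (rule AE_mp, intro AE_I2 impI)
    fix \<omega> assume "\<omega> \<in> space M" and "\<forall>\<^sub>F k in sequentially.
      \<omega> \<notin> {\<omega> \<in> space M. ?c * 2 ^ k < total_excess K \<epsilon> (2 ^ k) \<omega>}"
    then obtain k0 where k0: "\<And>k. k0 \<le> k \<Longrightarrow> total_excess K \<epsilon> (2 ^ k) \<omega> \<le> ?c * 2 ^ k"
      by (auto simp: eventually_sequentially not_less)
    show "\<forall>\<^sub>F n in sequentially. total_excess K \<epsilon> n \<omega> \<le> 2 * ?c * real n"
    proof (rule eventually_sequentiallyI)
      fix n :: nat assume n: "max 2 (2 ^ k0) \<le> n"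
      then obtain j where j: "2 ^ j < n" "n \<le> 2 ^ (j + 1)"
        using ex_power_ivl2[of 2 n] by auto
      have "(2::nat) ^ k0 \<le> 2 ^ (j + 1)" using n j(2) by simp
      then have "k0 \<le> j + 1" by (rule power_le_imp_le_exp[rotated]) simp
      have "total_excess K \<epsilon> n \<omega> \<le> total_excess K \<epsilon> (2 ^ (j + 1)) \<omega>"
        using j(2) by (rule total_excess_mono)
      also have "\<dots> \<le> ?c * 2 ^ (j + 1)" using \<open>k0 \<le> j + 1\<close> by (rule k0)
      also have "\<dots> \<le> ?c * (2 * real n)"
      proof (rule mult_left_mono[OF _ c])
        have "real (2 ^ j) \<le> real n" using j(1) by (simp only: of_nat_le_iff)
        then show "2 ^ (j + 1) \<le> 2 * real n" by simp
      qed
      finally show "total_excess K \<epsilon> n \<omega> \<le> 2 * ?c * real n" by (simp add: mult_ac)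
    qed
  qed
qed

end

section \<open>Convergence\<close>

context weighted_random_digraph
begin

lemma v_pos_AE: "AE \<omega> in M. \<forall>e\<in>edges. 0 < v e \<omega>"
proof (rule AE_ball_countable')
  fix e assume e: "e \<in> edges"
  have "AE x in distr M borel (v e). 0 < x" by (subst law[OF e]) (rule law_pos)
  then show "AE \<omega> in M. 0 < v e \<omega>"
    by (subst (asm) AE_distr_iff[OF v_measurable[OF e]]) simp_all
qed simp

lemma rate_mono:
  assumes "0 \<le> K" "K \<le> L"
  shows "rate K \<le> rate L"
proof (rule LIMSEQ_le)
  show "(\<lambda>m. mean_max K m / real m) \<longlonglongrightarrow> rate K" "(\<lambda>m. mean_max L m / real m) \<longlonglongrightarrow> rate L"
    using assms by (auto intro!: rate_LIMSEQ)
  have "mean_max K m \<le> mean_max L m" for m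
    unfolding mean_max_def using assms
    by (intro integral_mono block_max_integrable) (auto simp: block_max_def intro!: opt_mono cut_mono)
  then show "\<exists>N. \<forall>m\<ge>N. mean_max K m / real m \<le> mean_max L m / real m"
    by (auto intro!: divide_right_mono)
qed

section \<open>The positive part of the maximal weight as a real random variable\<close>

definition lists_between :: "nat \<Rightarrow> int list set" where
  "lists_between n = {xs \<in> increasing_lists 0 (int n + 1). xs \<noteq> [] \<and> hd xs = 0 \<and> last xs = int n}"

lemma finite_lists_between [simp]: "finite (lists_between n)"
  by (simp add: lists_between_def)

lemma is_path_iff_lists_between:
  "is_path E 0 (int n) xs \<longleftrightarrow> xs \<in> lists_between n \<and> chain E xs"
  using path_in_increasing_lists[of E 0 "int n" xs]
  by (auto simp: lists_between_def is_path_iff_chain)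

text \<open>The default value 0 of \<open>opt\<close> replaces the value minus infinity, so this is
  \<open>w^+\<close> as a real number, without extended reals.\<close>

definition w_plus :: "nat \<Rightarrow> 'a \<Rightarrow> real" where
  "w_plus n \<omega> = opt (lists_between n) (\<lambda>e. present e \<omega>) (\<lambda>e. v e \<omega>)"

lemma w_plus_nonneg: "0 \<le> w_plus n \<omega>"
  by (simp add: w_plus_def opt_nonneg)

lemma path_weight_le_w_plus:
  "is_path (\<lambda>e. present e \<omega>) 0 (int n) xs \<Longrightarrow> path_weight (\<lambda>e. v e \<omega>) xs \<le> w_plus n \<omega>"
  unfolding w_plus_def is_path_iff_lists_between by (intro path_weight_le_opt) auto

lemma w_plus_leI:
  assumes "0 \<le> c"
    "\<And>xs. is_path (\<lambda>e. present e \<omega>) 0 (int n) xs \<Longrightarrow> path_weight (\<lambda>e. v e \<omega>) xs \<le> c"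
  shows "w_plus n \<omega> \<le> c"
  unfolding w_plus_def using assms by (intro opt_leI) (auto simp: is_path_iff_lists_between)

lemma real_of_ereal_max_w: "real_of_ereal (max (w 0 (int n) \<omega>) 0) = w_plus n \<omega>"
proof (cases "\<exists>xs. is_path (\<lambda>e. present e \<omega>) 0 (int n) xs")
  case True
  let ?P = "{xs. is_path (\<lambda>e. present e \<omega>) 0 (int n) xs}"
  let ?M = "Max (path_weight (\<lambda>e. v e \<omega>) ` ?P)"
  have ge: "path_weight (\<lambda>e. v e \<omega>) xs \<le> ?M" if "xs \<in> ?P" for xs
    using that finite_paths by (intro Max_ge) auto
  have "?M \<in> path_weight (\<lambda>e. v e \<omega>) ` ?P"
    using True finite_paths by (intro Max_in) auto
  then have "?M \<le> w_plus n \<omega>" using path_weight_le_w_plus by auto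
  moreover have "w_plus n \<omega> \<le> max ?M 0" using ge by (intro w_plus_leI) fastforce+
  ultimately have "max ?M 0 = w_plus n \<omega>" using w_plus_nonneg[of n \<omega>] by linarith
  moreover have "w 0 (int n) \<omega> = ereal ?M" using True by (simp add: w_def max_weight_def)
  moreover have "max (ereal ?M) 0 = ereal (max ?M 0)" by (simp add: max_def zero_ereal_def)
  ultimately show ?thesis by simp
next
  case False
  then have "w_plus n \<omega> \<le> 0" by (intro w_plus_leI) auto
  with False w_plus_nonneg[of n \<omega>] show ?thesis by (simp add: w_def max_weight_def)
qed

text \<open>One path of nonnegative weight makes the maximum finite and nonnegative, and then taking
  the positive part changes nothing. This transfers the limit from \<open>w^+\<close> back to
  \<open>w\<close>.\<close>

lemma w_eq_w_plus:
  assumes "is_path (\<lambda>e. present e \<omega>) 0 (int n) xs" "0 \<le> path_weight (\<lambda>e. v e \<omega>) xs"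
  shows "w 0 (int n) \<omega> = ereal (w_plus n \<omega>)"
proof -
  let ?P = "{xs. is_path (\<lambda>e. present e \<omega>) 0 (int n) xs}"
  have eq: "w 0 (int n) \<omega> = ereal (Max (path_weight (\<lambda>e. v e \<omega>) ` ?P))"
    using assms(1) by (auto simp: w_def max_weight_def)
  have "path_weight (\<lambda>e. v e \<omega>) xs \<le> Max (path_weight (\<lambda>e. v e \<omega>) ` ?P)"
    using assms(1) finite_paths by (intro Max_ge) auto
  with assms(2) have "0 \<le> w 0 (int n) \<omega>" by (simp add: eq)
  then have "max (w 0 (int n) \<omega>) 0 = w 0 (int n) \<omega>" by (rule max_absorb1)
  then show ?thesis using real_of_ereal_max_w[of n \<omega>] by (simp add: eq)
qed

lemma w_plus_measurable [measurable]: "random_variable borel (w_plus n)"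
proof -
  have "(\<lambda>\<omega>. if chain (\<lambda>e. present e \<omega>) xs then path_weight (\<lambda>e. v e \<omega>) xs else 0) \<in> borel_measurable M"
    if "xs \<in> insert [] (lists_between n)" for xs
  proof (cases "xs = []")
    case False
    with that have xs: "xs \<in> increasing_lists 0 (int n + 1)" by (auto simp: lists_between_def)
    have step: "(xs ! k, xs ! Suc k) \<in> edges" if "k < length xs - 1" for k
      by (rule subsetD[OF edges_in_subset_edges step_in_edges_in[OF xs]]) (use that in simp)
    have sorted: "sorted_wrt (<) xs" using xs by (simp add: increasing_lists_def)
    have "{\<omega> \<in> space M. \<forall>k\<in>{..<length xs - 1}. present (xs ! k, xs ! Suc k) \<omega>} \<in> events"
    proof (rule sets.sets_Collect_finite_All)
      show "{\<omega> \<in> space M. present (xs ! k, xs ! Suc k) \<omega>} \<in> events" if "k \<in> {..<length xs - 1}" for k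
        using that by (intro present_event step) simp
    qed simp
    then have "{\<omega> \<in> space M. chain (\<lambda>e. present e \<omega>) xs} \<in> events"
      by (simp only: chain_iff_steps[OF sorted] Ball_def lessThan_iff)
    moreover have "(\<lambda>\<omega>. path_weight (\<lambda>e. v e \<omega>) xs) \<in> borel_measurable M"
      unfolding path_weight_def by (intro borel_measurable_sum v_measurable step) simp
    ultimately show ?thesis by (intro measurable_If borel_measurable_const)
  qed simp
  then show ?thesis
    unfolding w_plus_def[abs_def] opt_def by (intro borel_measurable_Max) auto
qed

end

section \<open>Bounds for \<open>w^+\<close> and the limit of the rates\<close>

context weighted_random_digraph_L2
begin

lemma w_plus_integrable: "integrable M (w_plus n)"
proof (rule Bochner_Integration.integrable_bound)
  let ?S = "\<lambda>\<omega>. \<Sum>e\<in>edges_in 0 (int n + 1). \<bar>v e \<omega>\<bar>"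
  show "integrable M ?S"
    using edges_in_subset_edges by (intro Bochner_Integration.integrable_sum integrable_abs integrable_v) auto
  have "w_plus n \<omega> \<le> ?S \<omega>" for \<omega>
  proof (rule w_plus_leI)
    fix xs assume "is_path (\<lambda>e. present e \<omega>) 0 (int n) xs"
    then have "xs \<in> increasing_lists 0 (int n + 1)" by (rule path_in_increasing_lists)
    then have "path_weight (\<lambda>e. \<bar>v e \<omega>\<bar>) xs \<le> ?S \<omega>" by (rule path_weight_le_sum) simp
    moreover have "path_weight (\<lambda>e. v e \<omega>) xs \<le> path_weight (\<lambda>e. \<bar>v e \<omega>\<bar>) xs"
      by (rule path_weight_mono) simp
    ultimately show "path_weight (\<lambda>e. v e \<omega>) xs \<le> ?S \<omega>" by simp
  qed (simp add: sum_nonneg)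
  then show "AE \<omega> in M. norm (w_plus n \<omega>) \<le> norm (?S \<omega>)"
    by (intro AE_I2) (simp add: w_plus_nonneg sum_nonneg)
qed simp

lemma w_plus_le:
  assumes "0 \<le> K" "0 < \<epsilon>"
  shows "w_plus n \<omega> \<le> block_max K 0 (int n + 1) \<omega> + \<epsilon> * real n + total_excess K \<epsilon> n \<omega>"
proof (rule w_plus_leI)
  have "0 \<le> total_excess K \<epsilon> n \<omega>" unfolding total_excess_def by (intro sum_nonneg) simp
  with assms block_max_nonneg[of K 0 "int n + 1" \<omega>]
  show "0 \<le> block_max K 0 (int n + 1) \<omega> + \<epsilon> * real n + total_excess K \<epsilon> n \<omega>" by simp
  fix xs assume xs: "is_path (\<lambda>e. present e \<omega>) 0 (int n) xs"
  then have "path_weight (\<lambda>e. cut K (v e \<omega>)) xs \<le> block_max K 0 (int n + 1) \<omega>"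
    unfolding block_max_def by (intro path_weight_le_opt) (auto simp: is_path_iff_chain path_in_increasing_lists)
  with path_weight_le_cut[OF assms(2) xs, of \<omega> K]
  show "path_weight (\<lambda>e. v e \<omega>) xs \<le> block_max K 0 (int n + 1) \<omega> + \<epsilon> * real n + total_excess K \<epsilon> n \<omega>"
    by simp
qed

text \<open>The bound is stated for all large \<open>K\<close>, since any two such cuts are later
  compared in both directions.\<close>

lemma w_plus_upper:
  assumes "0 < \<delta>"
  shows "\<exists>K0. \<forall>K\<ge>K0. AE \<omega> in M. \<forall>\<^sub>F n in sequentially. w_plus n \<omega> \<le> (rate (real K) + \<delta>) * real n"
proof -
  \<comment> \<open>Six shares: one for the block maximum, one for the lengths, and four for the
    total excess, whose almost sure bound is twice \<open>\<epsilon> + \<epsilon>\<close> once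
    \<open>tail_moment K < \<epsilon> * \<epsilon>\<close>.\<close>
  define \<epsilon> where "\<epsilon> = \<delta> / 6"
  have \<epsilon>: "0 < \<epsilon>" using assms by (simp add: \<epsilon>_def)
  then have "\<forall>\<^sub>F K in sequentially. tail_moment (real K) < \<epsilon> * \<epsilon> \<and> 1 \<le> K"
    by (intro eventually_conj order_tendstoD(2)[OF tail_moment_LIMSEQ] eventually_ge_at_top) simp
  then obtain K0 where K0: "\<And>K. K0 \<le> K \<Longrightarrow> tail_moment (real K) < \<epsilon> * \<epsilon> \<and> 1 \<le> K"
    by (auto simp: eventually_sequentially)
  show ?thesis
  proof (intro exI[of _ K0] allI impI)
    fix K assume "K0 \<le> K"
    with K0 have K: "tail_moment (real K) < \<epsilon> * \<epsilon>" "0 < real K" by fastforce+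
    from block_max_upper[OF K(2)] total_excess_AE[OF of_nat_0_le_iff \<epsilon> \<epsilon>, of K]
    show "AE \<omega> in M. \<forall>\<^sub>F n in sequentially. w_plus n \<omega> \<le> (rate (real K) + \<delta>) * real n"
    proof (eventually_elim)
      case (elim \<omega>)
      have "\<forall>\<^sub>F n in sequentially. block_max K 0 (int n + 1) \<omega> \<le> (rate K + \<epsilon>) * real n" using elim(1) \<epsilon> by blast
      then show ?case
        using elim(2)
      proof eventually_elim
        case (elim n)
        have "tail_moment K / \<epsilon> \<le> \<epsilon>" using K(1) \<epsilon> by (simp add: divide_le_eq)
        then have "2 * (tail_moment K / \<epsilon> + \<epsilon>) * real n \<le> (4 * \<epsilon>) * real n"
          by (intro mult_right_mono) auto
        moreover have "w_plus n \<omega> \<le> block_max K 0 (int n + 1) \<omega> + \<epsilon> * real n + total_excess K \<epsilon> n \<omega>"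
          using \<epsilon> by (intro w_plus_le) auto
        ultimately have "w_plus n \<omega> \<le> (rate K + \<epsilon>) * real n + \<epsilon> * real n + (4 * \<epsilon>) * real n"
          using elim by linarith
        also have "\<dots> = (rate (real K) + \<delta>) * real n" by (simp add: \<epsilon>_def algebra_simps)
        finally show ?case .
      qed
    qed
  qed
qed

lemma w_plus_lower:
  assumes "0 < K"
  shows "AE \<omega> in M. \<forall>\<eta>>0. \<forall>\<^sub>F n in sequentially.
    (rate K - \<eta>) * real n \<le> w_plus n \<omega> \<and> w 0 (int n) \<omega> = ereal (w_plus n \<omega>)"
  using path_lower[OF assms] v_pos_AE
proof eventually_elim
  case (elim \<omega>)
  show ?case
  proof (intro allI impI)
    fix \<eta> :: real assume "0 < \<eta>"
    with elim(1) have "\<forall>\<^sub>F n in sequentially. \<exists>xs. is_path (\<lambda>e. present e \<omega>) 0 (int n) xs \<and>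
        (rate K - \<eta>) * real n \<le> path_weight (\<lambda>e. cut K (v e \<omega>)) xs" by blast
    then show "\<forall>\<^sub>F n in sequentially.
        (rate K - \<eta>) * real n \<le> w_plus n \<omega> \<and> w 0 (int n) \<omega> = ereal (w_plus n \<omega>)"
    proof (rule eventually_mono)
      fix n assume "\<exists>xs. is_path (\<lambda>e. present e \<omega>) 0 (int n) xs \<and>
        (rate K - \<eta>) * real n \<le> path_weight (\<lambda>e. cut K (v e \<omega>)) xs"
      then obtain xs where xs: "is_path (\<lambda>e. present e \<omega>) 0 (int n) xs"
        "(rate K - \<eta>) * real n \<le> path_weight (\<lambda>e. cut K (v e \<omega>)) xs" by blast
      \<comment> \<open>Cutting lowers a weight only if the weight is nonnegative; positivity on all
        edges, outside a null set, is used here.\<close>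
      have le: "path_weight (\<lambda>e. cut K (v e \<omega>)) xs \<le> path_weight (\<lambda>e. v e \<omega>) xs"
        using elim(2) edges_in_subset_edges
        by (intro path_weight_mono_edges[OF path_in_increasing_lists[OF xs(1)]] cut_le_self)
           (meson less_imp_le subsetD)
      have "0 \<le> path_weight (\<lambda>e. cut K (v e \<omega>)) xs" by (intro path_weight_nonneg) simp
      with le have "w 0 (int n) \<omega> = ereal (w_plus n \<omega>)" by (intro w_eq_w_plus[OF xs(1)]) simp
      with xs(2) le path_weight_le_w_plus[OF xs(1)]
      show "(rate K - \<eta>) * real n \<le> w_plus n \<omega> \<and> w 0 (int n) \<omega> = ereal (w_plus n \<omega>)" by simp
    qed
  qed
qed

text \<open>The same sequence \<open>w_plus n\<close> is bounded below through the cut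
  \<open>K\<close> and above through the cut \<open>L\<close>. The resulting inequality between
  constants holds almost surely, hence holds.\<close>

lemma rate_le_rate_add:
  assumes "0 < K" "AE \<omega> in M. \<forall>\<^sub>F n in sequentially. w_plus n \<omega> \<le> (rate L + \<delta>) * real n"
  shows "rate K \<le> rate L + \<delta>"
proof (rule field_le_epsilon)
  fix \<eta> :: real assume "0 < \<eta>"
  from w_plus_lower[OF assms(1)] assms(2) have "AE \<omega> in M. rate K \<le> rate L + \<delta> + \<eta>"
  proof eventually_elim
    case (elim \<omega>)
    have "\<forall>\<^sub>F n in sequentially. (rate K - \<eta>) * real n \<le> w_plus n \<omega>"
      using elim(1) \<open>0 < \<eta>\<close> by (auto elim: eventually_mono)
    with elim(2) eventually_gt_at_top[of 0]
    have "\<forall>\<^sub>F n in sequentially. rate K \<le> rate L + \<delta> + \<eta>"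
    proof eventually_elim
      case (elim n)
      then have "(rate K - \<eta>) * real n \<le> (rate L + \<delta>) * real n" by linarith
      with elim(2) show ?case by simp
    qed
    then show ?case by simp
  qed
  then show "rate K \<le> rate L + \<delta> + \<eta>" by simp
qed

text \<open>The comparison applies with the two cuts in either order, which gives the Cauchy
  property and with it the finiteness of the limit.\<close>

lemma rate_convergent: "convergent (\<lambda>K. rate (real K))"
proof (rule Cauchy_convergent, rule CauchyI)
  fix e :: real assume "0 < e"
  then obtain K0 where K0: "\<And>K. K0 \<le> K \<Longrightarrow>
      AE \<omega> in M. \<forall>\<^sub>F n in sequentially. w_plus n \<omega> \<le> (rate (real K) + e / 2) * real n"
    using w_plus_upper[of "e / 2"] by auto
  have le: "rate (real K) \<le> rate (real L) + e / 2" if "Suc K0 \<le> K" "Suc K0 \<le> L" for K L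
    using that by (intro rate_le_rate_add K0) auto
  show "\<exists>N. \<forall>m\<ge>N. \<forall>n\<ge>N. norm (rate (real m) - rate (real n)) < e"
  proof (intro exI[of _ "Suc K0"] allI impI)
    fix m n assume "Suc K0 \<le> m" "Suc K0 \<le> n"
    with le[of m n] le[of n m] \<open>0 < e\<close> show "norm (rate (real m) - rate (real n)) < e"
      by (simp add: abs_le_iff abs_less_iff)
  qed
qed

definition limit_rate :: real where "limit_rate = lim (\<lambda>K. rate (real K))"

lemma rate_tendsto: "(\<lambda>K. rate (real K)) \<longlonglongrightarrow> limit_rate"
  unfolding limit_rate_def using rate_convergent by (simp add: convergent_LIMSEQ_iff)

lemma limit_rate_pos: "0 < limit_rate"
proof -
  have "rate 1 \<le> limit_rate"
    by (rule LIMSEQ_le_const[OF rate_tendsto]) (auto intro!: exI[of _ 1] rate_mono)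
  with rate_pos[of 1] show ?thesis by simp
qed

lemma w_plus_AE:
  "AE \<omega> in M. (\<lambda>n. w_plus n \<omega> / real n) \<longlonglongrightarrow> limit_rate \<and>
     (\<forall>\<^sub>F n in sequentially. w 0 (int n) \<omega> = ereal (w_plus n \<omega>))"
proof -
  \<comment> \<open>For each precision one cut is fixed whose rate is close to the limit and for
    which the upper bound holds. Only countably many null sets are then discarded.\<close>
  define G where "G j K \<longleftrightarrow> 0 < K \<and> \<bar>rate (real K) - limit_rate\<bar> < inverse (real (Suc j)) \<and>
      (AE \<omega> in M. \<forall>\<^sub>F n in sequentially. w_plus n \<omega> \<le> (rate (real K) + inverse (real (Suc j))) * real n)"
    for j K :: nat
  have "\<exists>K. G j K" for j
  proof -
    obtain K0 where K0: "\<And>K. K0 \<le> K \<Longrightarrow> AE \<omega> in M. \<forall>\<^sub>F n in sequentially.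
        w_plus n \<omega> \<le> (rate (real K) + inverse (real (Suc j))) * real n"
      using w_plus_upper[of "inverse (real (Suc j))"] by auto
    have "\<forall>\<^sub>F K in sequentially. dist (rate (real K)) limit_rate < inverse (real (Suc j))"
      using rate_tendsto by (rule tendstoD) simp
    then have "\<forall>\<^sub>F K in sequentially. dist (rate (real K)) limit_rate < inverse (real (Suc j)) \<and> max 1 K0 \<le> K"
      by (intro eventually_conj eventually_ge_at_top)
    then obtain K where "dist (rate (real K)) limit_rate < inverse (real (Suc j))" "max 1 K0 \<le> K"
      by (auto simp: eventually_sequentially)
    with K0[of K] show ?thesis by (intro exI[of _ K]) (auto simp: dist_real_def G_def)
  qed
  then obtain k where "\<And>j. G j (k j)" by metis
  then have k: "\<And>j. 0 < k j" "\<And>j. \<bar>rate (real (k j)) - limit_rate\<bar> < inverse (real (Suc j))"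
    "\<And>j. AE \<omega> in M. \<forall>\<^sub>F n in sequentially. w_plus n \<omega> \<le> (rate (real (k j)) + inverse (real (Suc j))) * real n"
    unfolding G_def by blast+
  have "AE \<omega> in M. \<forall>j. \<forall>\<^sub>F n in sequentially. w_plus n \<omega> \<le> (rate (real (k j)) + inverse (real (Suc j))) * real n"
    unfolding AE_all_countable by (intro allI k(3))
  moreover have "AE \<omega> in M. \<forall>j. \<forall>\<eta>>0. \<forall>\<^sub>F n in sequentially.
      (rate (real (k j)) - \<eta>) * real n \<le> w_plus n \<omega> \<and> w 0 (int n) \<omega> = ereal (w_plus n \<omega>)"
    unfolding AE_all_countable using k(1) by (intro allI w_plus_lower) simp
  ultimately show ?thesis
  proof eventually_elim
    case (elim \<omega>)
    have "(\<lambda>n. w_plus n \<omega> / real n) \<longlonglongrightarrow> limit_rate"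
    proof (rule tendstoI)
      fix e :: real assume "0 < e"
      then obtain j where j: "inverse (real (Suc j)) < e / 2" using reals_Archimedean[of "e / 2"] by auto
      let ?d = "inverse (real (Suc j))"
      have "0 < ?d" by simp
      with elim(2) have "\<forall>\<^sub>F n in sequentially.
          (rate (real (k j)) - ?d) * real n \<le> w_plus n \<omega> \<and> w 0 (int n) \<omega> = ereal (w_plus n \<omega>)" by blast
      moreover have "\<forall>\<^sub>F n in sequentially. w_plus n \<omega> \<le> (rate (real (k j)) + ?d) * real n"
        using elim(1) by blast
      ultimately show "\<forall>\<^sub>F n in sequentially. dist (w_plus n \<omega> / real n) limit_rate < e"
        using eventually_gt_at_top[of 0]
      proof eventually_elim
        case (elim n)
        then have "rate (real (k j)) - ?d \<le> w_plus n \<omega> / real n" "w_plus n \<omega> / real n \<le> rate (real (k j)) + ?d"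
          by (simp_all add: pos_le_divide_eq pos_divide_le_eq)
        with k(2)[of j] j show ?case unfolding dist_real_def by linarith
      qed
    qed
    moreover have "\<forall>\<^sub>F n in sequentially. w 0 (int n) \<omega> = ereal (w_plus n \<omega>)"
      using elim(2)[rule_format, of 1 0] by (auto elim: eventually_mono)
    ultimately show ?case by blast
  qed
qed

lemma w_AE: "AE \<omega> in M. (\<lambda>n. w 0 (int n) \<omega> / ereal (real n)) \<longlonglongrightarrow> ereal limit_rate"
  using w_plus_AE
proof eventually_elim
  case (elim \<omega>)
  have "(\<lambda>n. ereal (w_plus n \<omega> / real n)) \<longlonglongrightarrow> ereal limit_rate"
    using elim by (simp add: lim_ereal)
  moreover have "\<forall>\<^sub>F n in sequentially. ereal (w_plus n \<omega> / real n) = w 0 (int n) \<omega> / ereal (real n)"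
    using elim[THEN conjunct2] eventually_gt_at_top[of 0] by eventually_elim simp
  ultimately show ?case by (rule Lim_transform_eventually)
qed

text \<open>Uniform integrability comes from \<open>w\<^sub>0\<^sub>n\<^sup>+ / n \<le> D + total_excess / n\<close>, where the expectation of the last
  term is arbitrarily small for large \<open>K\<close>.\<close>

lemma w_plus_L1: "(\<lambda>n. expectation (\<lambda>\<omega>. \<bar>w_plus n \<omega> / real n - limit_rate\<bar>)) \<longlonglongrightarrow> 0"
proof (rule order_tendstoI)
  fix a :: real assume "a < 0"
  then show "\<forall>\<^sub>F n in sequentially. a < expectation (\<lambda>\<omega>. \<bar>w_plus n \<omega> / real n - limit_rate\<bar>)"
    by (intro always_eventually allI) (rule less_le_trans, auto intro!: Bochner_Integration.integral_nonneg)
next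
  fix a :: real assume "0 < a"
  \<comment> \<open>One half for the truncated difference, one half for the mean excess beyond the
    truncation level.\<close>
  define \<epsilon> where "\<epsilon> = a / 2"
  have \<epsilon>: "0 < \<epsilon>" using \<open>0 < a\<close> by (simp add: \<epsilon>_def)
  then have "\<forall>\<^sub>F K in sequentially. tail_moment (real K) < \<epsilon> * \<epsilon>"
    by (intro order_tendstoD(2)[OF tail_moment_LIMSEQ]) simp
  then obtain K where "tail_moment (real K) < \<epsilon> * \<epsilon>" by (auto simp: eventually_sequentially)
  then have q: "tail_moment (real K) / \<epsilon> \<le> \<epsilon>" using \<epsilon> by (simp add: divide_le_eq)
  \<comment> \<open>For \<open>n \<ge> 1\<close> one has
    \<open>K * (n + 1) + \<epsilon> * n \<le> (2 * K + \<epsilon>) * n\<close>, so only the excess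
    can lift \<open>w^+ / n\<close> above \<open>D\<close>. The maximum with
    \<open>limit_rate\<close> keeps the truncation from moving the limit.\<close>
  define D where "D = max (2 * real K + \<epsilon>) limit_rate"
  have D: "0 \<le> D" "limit_rate \<le> D" using \<epsilon> by (auto simp: D_def)
  let ?Z = "\<lambda>n \<omega>. w_plus n \<omega> / real n"
  let ?F = "\<lambda>n \<omega>. \<bar>min (?Z n \<omega>) D - limit_rate\<bar>"
  have int_Z: "integrable M (?Z n)" for n by (simp add: w_plus_integrable)
  have bound_F: "?F n \<omega> \<le> D + limit_rate" for n \<omega>
  proof -
    have "0 \<le> ?Z n \<omega>" by (simp add: w_plus_nonneg)
    with D limit_rate_pos show ?thesis by linarith
  qed
  have int_F: "integrable M (?F n)" for n
    by (rule integrable_const_bound[where B = "D + limit_rate"]) (use bound_F in auto)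
  have "(\<lambda>n. expectation (?F n)) \<longlonglongrightarrow> expectation (\<lambda>\<omega>. 0)"
  proof (rule integral_dominated_convergence[where w = "\<lambda>_. D + limit_rate"])
    show "AE \<omega> in M. (\<lambda>n. ?F n \<omega>) \<longlonglongrightarrow> 0"
      using w_plus_AE
    proof eventually_elim
      case (elim \<omega>)
      then have "(\<lambda>n. ?F n \<omega>) \<longlonglongrightarrow> \<bar>min limit_rate D - limit_rate\<bar>"
        by (intro tendsto_rabs tendsto_diff tendsto_min tendsto_const) auto
      with D(2) show ?case by (simp add: min_absorb1)
    qed
  qed (use bound_F in auto)
  then have "\<forall>\<^sub>F n in sequentially. expectation (?F n) < \<epsilon>"
    using \<epsilon> by (intro order_tendstoD) auto
  then show "\<forall>\<^sub>F n in sequentially. expectation (\<lambda>\<omega>. \<bar>?Z n \<omega> - limit_rate\<bar>) < a"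
    using eventually_gt_at_top[of 0]
  proof eventually_elim
    case (elim n)
    have TE: "integrable M (total_excess (real K) \<epsilon> n)"
      "expectation (total_excess (real K) \<epsilon> n) \<le> real n * (tail_moment (real K) / \<epsilon>)"
      using \<epsilon> by (intro expectation_total_excess; simp)+
    \<comment> \<open>The distance splits into that of the truncated variable and the overshoot of
      \<open>?Z n \<omega>\<close> above \<open>D\<close>, which is at most the normalised
      excess.\<close>
    have "\<bar>?Z n \<omega> - limit_rate\<bar> \<le> ?F n \<omega> + total_excess (real K) \<epsilon> n \<omega> / real n" for \<omega>
    proof -
      have "w_plus n \<omega> \<le> real K * (real n + 1) + \<epsilon> * real n + total_excess (real K) \<epsilon> n \<omega>"
        using w_plus_le[of "real K" \<epsilon> n \<omega>] block_max_le[of "real K" 0 "int n + 1" \<omega>] \<epsilon> by simp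
      also have "\<dots> \<le> real K * (2 * real n) + \<epsilon> * real n + total_excess (real K) \<epsilon> n \<omega>"
        using elim(2) by (intro add_right_mono mult_left_mono) auto
      also have "\<dots> = (2 * real K + \<epsilon>) * real n + total_excess (real K) \<epsilon> n \<omega>"
        by (simp add: algebra_simps)
      finally have "?Z n \<omega> \<le> (2 * real K + \<epsilon>) + total_excess (real K) \<epsilon> n \<omega> / real n"
        using elim(2) by (simp add: field_simps)
      also have "\<dots> \<le> D + total_excess (real K) \<epsilon> n \<omega> / real n" by (simp add: D_def)
      finally have "?Z n \<omega> \<le> D + total_excess (real K) \<epsilon> n \<omega> / real n" .
      moreover have "0 \<le> total_excess (real K) \<epsilon> n \<omega> / real n"
        unfolding total_excess_def by (intro divide_nonneg_nonneg sum_nonneg) auto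
      ultimately show ?thesis by linarith
    qed
    then have "expectation (\<lambda>\<omega>. \<bar>?Z n \<omega> - limit_rate\<bar>) \<le>
        expectation (\<lambda>\<omega>. ?F n \<omega> + total_excess (real K) \<epsilon> n \<omega> / real n)"
      using int_Z int_F TE(1)
      by (intro integral_mono Bochner_Integration.integrable_add integrable_abs
          Bochner_Integration.integrable_diff integrable_divide) (auto simp: w_plus_integrable)
    also have "\<dots> = expectation (?F n) + expectation (total_excess (real K) \<epsilon> n) / real n"
      using int_F TE(1) by simp
    also have "expectation (total_excess (real K) \<epsilon> n) / real n \<le> tail_moment (real K) / \<epsilon>"
      using TE(2) elim(2) by (simp add: pos_divide_le_eq mult.commute)
    finally show ?case using elim(1) q by (simp add: \<epsilon>_def)
  qed
qed

end

theorem theorem2p1: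
  fixes M :: "'a measure" and p :: real and \<nu> :: "real measure"
    and v :: "int \<times> int \<Rightarrow> 'a \<Rightarrow> real"
    and present :: "int \<times> int \<Rightarrow> 'a \<Rightarrow> bool"
  assumes "weighted_random_digraph M p \<nu> v present"
    and "integrable \<nu> (\<lambda>x. x\<^sup>2)"
  shows "\<exists>C::real. 0 < C \<and>
    (AE \<omega> in M.
       (\<lambda>n::nat. weighted_random_digraph.w v present 0 (int n) \<omega> / ereal (real n))
         \<longlonglongrightarrow> ereal C) \<and>
    converges_in_L1 M
      (\<lambda>n \<omega>. real_of_ereal (max (weighted_random_digraph.w v present 0 (int n) \<omega>) 0) / real n)
      (\<lambda>\<omega>. C)"
proof -
  interpret weighted_random_digraph M p \<nu> v present by (rule assms(1))
  interpret weighted_random_digraph_L2 M p \<nu> v present by unfold_locales (rule assms(2))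
  show ?thesis
    using limit_rate_pos w_AE w_plus_L1 w_plus_integrable
    by (intro exI[of _ limit_rate]) (simp add: converges_in_L1_def real_of_ereal_max_w)
qed

end
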